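(* Let $n\ge 4$, $\alpha\in(0,1]$, let $\epsilon_1,\dots,\epsilon_{n-2}>0$ and $\tilde\epsilon_1,\dots,\tilde\epsilon_{n-3}>0$, let $z_1=0$, and let the points $z_1,\dots,z_{n-2}$ lie on the circle $|z-1|=1$. Put $w_p=i\ln(1-z_p)$. The accessory equations for $c_1,\dots,c_{n-2}$ and the momentum equations for $s_1,\dots,s_{n-2},\tilde s_1,\dots,\tilde s_{n-3},D^\pm_k$ (both written out in the context) are weakly equivalent. That is, the two algebraic systems have at least one common root $\{c_k\}\to\{s_k\}$ under the transformations $$z\to w,\quad w=i\ln(1-z),\qquad f(z)\to S(w),\quad f(z)=S(w)+i\sum_{k=1}^{n-2}\epsilon_kw_k .$$ Under these transformations the unknowns of the two systems are related by $$c_1=\epsilon_1\frac{1+i\alpha s_1}{1-z_1},\qquad c_k=\epsilon_k\frac{1-i\alpha s_k}{1-z_k}\quad(2\le k\le n-2).$$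
   Context: Weak equivalence. Consider two potential vector fields $A_i(x)=\partial U(x)/\partial x^i$ and $\widetilde A_i(y)=\partial\widetilde U(y)/\partial y^i$, $i=1,\dots,n-2$. The components of each are subject to a non-degenerate system of algebraic equations, $C_\alpha(A,B)=0$ and $\widetilde C_\beta(\widetilde A,\widetilde B)=0$, possibly with auxiliary variables $B$, $\widetilde B$. The coefficients may depend on the coordinates and on additional parameters. The two systems are called weakly equivalent if the two algebraic systems have at least one common root $\{A^0_i(x)\}\to\{\widetilde A^0_i(y)\}$ under transformations $x\to y$, $U(x)\to\widetilde U(y)$. Here the first system has coordinates $z_k$, potential $f(z)$ (the perturbative classical $n$-point conformal block), components $c_k=\partial f/\partial z_k$ (accessory parameters) and no auxiliary variables. The second has coordinates $w_k$, potential $S(w)$ (the on-shell worldline action of the dual geodesic network on the hyperbolic disk), components given by the angular parameters $s_k=\frac{1}{\alpha\epsilon_k}\partial S/\partial w_k$ (for $k=1$ with the opposite sign convention, since the flow of the first line is oppositely directed), and auxiliary variables $\tilde s_j$, $D_k^\pm$. The $s_k$ and $\tilde s_j$ are the angular parameters (absolute values of the angular momenta divided by $\alpha$, per unit mass) of the external and exchanged geodesic segments. Conventions: $\tilde\epsilon_0:=\epsilon_1$, $\tilde s_0:=s_1$; empty sums are $0$; $a_p:=(1-z_p)^\alpha=e^{-i\alpha w_p}$, $A_p=a_p(1+is_p)$, $\bar A_p=a_p^{-1}(1-is_p)$. Accessory equations: $$c_1=-\sum_{i=2}^{n-2}\big[c_i(1-z_i)-\epsilon_i\big]+\epsilon_1,\qquad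 \big(I^{(k)}_{++}\big)^2+I^{(k)}_{-+}I^{(k)}_{+-}=-4\pi^2\tilde\epsilon_k^2,\quad k=1,\dots,n-3,$$ where $$I^{(k)}_{+-}=\frac{2\pi i}{\alpha}\Big[\alpha\epsilon_1+\sum_{i=2}^{n-2}(c_i(1-z_i)-\epsilon_i)-\sum_{i=2}^{k+1}(1-z_i)^{\alpha}\big(c_i(1-z_i)-\epsilon_i(1+\alpha)\big)\Big],$$ $$I^{(k)}_{++}=\frac{2\pi i}{\alpha}\sum_{i=k+2}^{n-2}\big[c_i(1-z_i)-\epsilon_i\big],$$ and $I^{(k)}_{-+}$ is obtained from $I^{(k)}_{+-}$ by replacing $\alpha$ with $-\alpha$ (with $c_i,z_i,\epsilon_i$ kept fixed). Momentum equations: $$\epsilon_i s_i+\tilde\epsilon_{i-1}\tilde s_{i-1}-\tilde\epsilon_{i-2}\tilde s_{i-2}=0\quad(i=2,\dots,n-2),\qquad \tilde s_{n-3}=0,$$ $$\mathrm{Re}\,D^+_{k+1}=-(s_{k+1}\tilde s_{k-1}+\sigma_{k+1})\quad(k=1,\dots,n-3),\qquad \sigma_k=\frac{\epsilon_k^2+\tilde\epsilon_{k-2}^2-\tilde\epsilon_{k-1}^2}{2\epsilon_k\tilde\epsilon_{k-2}},$$ where the variables $D^\pm_k$ satisfy $$D^-_1=\bar A_1^2,\qquad \tilde\epsilon_{k-1}D^-_k-\tilde\epsilon_{k-2}D^+_k=\epsilon_kA_k\bar A_k\quad(k=2,\dots,n-2),$$ $$D^+_k=\frac{\bar A_k}{\bar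 A_{k-1}}D^-_{k-1}\quad(k=2,\dots,n-2).$$
   Formalization: The points z_k are assumed distinct; a common root with real s_k is claimed only if the momentum equations have a real root (they may have none); otherwise a complex root, with Re D read as half the sum of D and a formal conjugate and the D^+ quotient cleared. *)

theory Defs
  imports "HOL-Complex_Analysis.Complex_Analysis"
begin

section \<open>Potentials and weak equivalence\<close>

text \<open>
  Points of m-dimensional complex space are functions on \<open>nat\<close> of which only the values at
  \<open>1, \<dots>, m\<close> matter.
\<close>

definition near :: "nat \<Rightarrow> real \<Rightarrow> (nat \<Rightarrow> complex) \<Rightarrow> (nat \<Rightarrow> complex) \<Rightarrow> bool" where
  "near m \<delta> x \<xi> \<longleftrightarrow> (\<forall>p\<in>{1..m}. dist (\<xi> p) (x p) < \<delta>)"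

definition partial_deriv :: "((nat \<Rightarrow> complex) \<Rightarrow> complex) \<Rightarrow> (nat \<Rightarrow> complex) \<Rightarrow> nat \<Rightarrow> complex" where
  "partial_deriv U x k = deriv (\<lambda>t. U (x(k := t))) (x k)"

text \<open>Holomorphy in each variable separately on a polydisc, which is holomorphy by Hartogs' theorem.\<close>

definition holomorphic_potential_at ::
    "nat \<Rightarrow> ((nat \<Rightarrow> complex) \<Rightarrow> complex) \<Rightarrow> (nat \<Rightarrow> complex) \<Rightarrow> bool" where
  "holomorphic_potential_at m U x \<longleftrightarrow>
     (\<exists>\<delta>>0. \<forall>\<xi>. near m \<delta> x \<xi> \<longrightarrow>
        (\<forall>k\<in>{1..m}. (\<lambda>t. U (\<xi>(k := t))) field_differentiable at (\<xi> k)))"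

text \<open>
  \<open>C x A B\<close> says that the components \<open>A\<close> and the auxiliary variables \<open>B\<close> solve the first system,
  whose coefficients depend on the point \<open>x\<close>; likewise \<open>C'\<close> at the transformed point \<open>y\<close>.  The
  relation \<open>T U U'\<close> is the transformation of potentials.  A common root is a root of the first
  system that is the gradient at \<open>x\<close> of a potential \<open>U\<close>, such that the gradient at \<open>y\<close> of the
  transformed potential is a root of the second system.
\<close>

definition weakly_equivalent_at ::
    "nat \<Rightarrow> (nat \<Rightarrow> complex) \<Rightarrow> (nat \<Rightarrow> complex)
     \<Rightarrow> (((nat \<Rightarrow> complex) \<Rightarrow> complex) \<Rightarrow> ((nat \<Rightarrow> complex) \<Rightarrow> complex) \<Rightarrow> bool)
     \<Rightarrow> ((nat \<Rightarrow> complex) \<Rightarrow> (nat \<Rightarrow> complex) \<Rightarrow> 'b \<Rightarrow> bool)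
     \<Rightarrow> ((nat \<Rightarrow> complex) \<Rightarrow> (nat \<Rightarrow> complex) \<Rightarrow> 'c \<Rightarrow> bool) \<Rightarrow> bool" where
  "weakly_equivalent_at m x y T C C' \<longleftrightarrow>
     (\<exists>U U'. holomorphic_potential_at m U x \<and> holomorphic_potential_at m U' y \<and> T U U' \<and>
        (\<exists>B. C x (partial_deriv U x) B) \<and> (\<exists>B'. C' y (partial_deriv U' y) B'))"


section \<open>The transformation from the block to the worldline action\<close>

definition w_of :: "(nat \<Rightarrow> complex) \<Rightarrow> nat \<Rightarrow> complex" where
  "w_of z p = \<i> * Ln (1 - z p)"

definition potentials_related ::
    "nat \<Rightarrow> (nat \<Rightarrow> real) \<Rightarrow> (nat \<Rightarrow> complex)
     \<Rightarrow> ((nat \<Rightarrow> complex) \<Rightarrow> complex) \<Rightarrow> ((nat \<Rightarrow> complex) \<Rightarrow> complex) \<Rightarrow> bool" where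
  "potentials_related n \<epsilon> z f S \<longleftrightarrow>
     (\<exists>\<delta>>0. \<forall>\<zeta>. near (n - 2) \<delta> z \<zeta> \<longrightarrow>
        f \<zeta> = S (w_of \<zeta>) + \<i> * (\<Sum>k=1..n-2. of_real (\<epsilon> k) * w_of \<zeta> k))"

definition angular :: "real \<Rightarrow> (nat \<Rightarrow> real) \<Rightarrow> (nat \<Rightarrow> complex) \<Rightarrow> nat \<Rightarrow> complex" where
  "angular \<alpha> \<epsilon> G k = (if k = 1 then - 1 else 1) / of_real (\<alpha> * \<epsilon> k) * G k"


section \<open>The accessory equations\<close>

definition I_pm ::
    "real \<Rightarrow> (nat \<Rightarrow> real) \<Rightarrow> nat \<Rightarrow> (nat \<Rightarrow> complex) \<Rightarrow> (nat \<Rightarrow> complex) \<Rightarrow> nat \<Rightarrow> complex" where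
  "I_pm \<alpha> \<epsilon> n z c k = 2 * of_real pi * \<i> / of_real \<alpha> *
     (of_real (\<alpha> * \<epsilon> 1) + (\<Sum>i=2..n-2. c i * (1 - z i) - of_real (\<epsilon> i))
      - (\<Sum>i=2..k+1. (1 - z i) powr of_real \<alpha> *
            (c i * (1 - z i) - of_real (\<epsilon> i * (1 + \<alpha>)))))"

definition I_mp ::
    "real \<Rightarrow> (nat \<Rightarrow> real) \<Rightarrow> nat \<Rightarrow> (nat \<Rightarrow> complex) \<Rightarrow> (nat \<Rightarrow> complex) \<Rightarrow> nat \<Rightarrow> complex" where
  "I_mp \<alpha> \<epsilon> n z c k = I_pm (- \<alpha>) \<epsilon> n z c k"

definition I_pp ::
    "real \<Rightarrow> (nat \<Rightarrow> real) \<Rightarrow> nat \<Rightarrow> (nat \<Rightarrow> complex) \<Rightarrow> (nat \<Rightarrow> complex) \<Rightarrow> nat \<Rightarrow> complex" where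
  "I_pp \<alpha> \<epsilon> n z c k = 2 * of_real pi * \<i> / of_real \<alpha> *
     (\<Sum>i=k+2..n-2. c i * (1 - z i) - of_real (\<epsilon> i))"

definition accessory_eqs ::
    "nat \<Rightarrow> real \<Rightarrow> (nat \<Rightarrow> real) \<Rightarrow> (nat \<Rightarrow> real) \<Rightarrow> (nat \<Rightarrow> complex) \<Rightarrow> (nat \<Rightarrow> complex) \<Rightarrow> bool" where
  "accessory_eqs n \<alpha> \<epsilon> \<epsilon>t z c \<longleftrightarrow>
     c 1 = - (\<Sum>i=2..n-2. c i * (1 - z i) - of_real (\<epsilon> i)) + of_real (\<epsilon> 1) \<and>
     (\<forall>k\<in>{1..n-3}. (I_pp \<alpha> \<epsilon> n z c k)\<^sup>2 + I_mp \<alpha> \<epsilon> n z c k * I_pm \<alpha> \<epsilon> n z c k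
        = of_real (- 4 * pi\<^sup>2 * (\<epsilon>t k)\<^sup>2))"


section \<open>The momentum equations\<close>

text \<open>\<open>ext0\<close> implements the conventions for the exchanged segment number 0.\<close>

definition ext0 :: "(nat \<Rightarrow> 'a) \<Rightarrow> (nat \<Rightarrow> 'a) \<Rightarrow> nat \<Rightarrow> 'a" where
  "ext0 g gt = gt(0 := g 1)"

definition \<sigma> :: "(nat \<Rightarrow> real) \<Rightarrow> (nat \<Rightarrow> real) \<Rightarrow> nat \<Rightarrow> real" where
  "\<sigma> \<epsilon> \<epsilon>t k = (let et = ext0 \<epsilon> \<epsilon>t in
     ((\<epsilon> k)\<^sup>2 + (et (k - 2))\<^sup>2 - (et (k - 1))\<^sup>2) / (2 * \<epsilon> k * et (k - 2)))"

definition a_of :: "real \<Rightarrow> (nat \<Rightarrow> complex) \<Rightarrow> nat \<Rightarrow> complex" where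
  "a_of \<alpha> w p = exp (- \<i> * of_real \<alpha> * w p)"

definition A_of :: "real \<Rightarrow> (nat \<Rightarrow> complex) \<Rightarrow> (nat \<Rightarrow> complex) \<Rightarrow> nat \<Rightarrow> complex" where
  "A_of \<alpha> w s p = a_of \<alpha> w p * (1 + \<i> * s p)"

definition Abar_of :: "real \<Rightarrow> (nat \<Rightarrow> complex) \<Rightarrow> (nat \<Rightarrow> complex) \<Rightarrow> nat \<Rightarrow> complex" where
  "Abar_of \<alpha> w s p = inverse (a_of \<alpha> w p) * (1 - \<i> * s p)"

definition vertex_eqs ::
    "nat \<Rightarrow> (nat \<Rightarrow> real) \<Rightarrow> (nat \<Rightarrow> real) \<Rightarrow> (nat \<Rightarrow> complex) \<Rightarrow> (nat \<Rightarrow> complex) \<Rightarrow> bool" where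
  "vertex_eqs n \<epsilon> \<epsilon>t s st \<longleftrightarrow> (let et = ext0 \<epsilon> \<epsilon>t; sx = ext0 s st in
     (\<forall>i\<in>{2..n-2}. of_real (\<epsilon> i) * s i + of_real (et (i - 1)) * sx (i - 1)
        - of_real (et (i - 2)) * sx (i - 2) = 0) \<and> st (n - 3) = 0)"

text \<open>The momentum equations verbatim, for real angular parameters.\<close>

definition momentum_eqs ::
    "nat \<Rightarrow> real \<Rightarrow> (nat \<Rightarrow> real) \<Rightarrow> (nat \<Rightarrow> real) \<Rightarrow> (nat \<Rightarrow> complex)
     \<Rightarrow> (nat \<Rightarrow> real) \<Rightarrow> (nat \<Rightarrow> real) \<Rightarrow> (nat \<Rightarrow> complex) \<Rightarrow> (nat \<Rightarrow> complex) \<Rightarrow> bool" where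
  "momentum_eqs n \<alpha> \<epsilon> \<epsilon>t w s st Dp Dm \<longleftrightarrow>
     (let et = ext0 \<epsilon> \<epsilon>t; sx = ext0 s st;
          A = A_of \<alpha> w (of_real \<circ> s); Ab = Abar_of \<alpha> w (of_real \<circ> s) in
      vertex_eqs n \<epsilon> \<epsilon>t (of_real \<circ> s) (of_real \<circ> st) \<and>
      (\<forall>k\<in>{1..n-3}. Re (Dp (k + 1)) = - (s (k + 1) * sx (k - 1) + \<sigma> \<epsilon> \<epsilon>t (k + 1))) \<and>
      Dm 1 = (Ab 1)\<^sup>2 \<and>
      (\<forall>k\<in>{2..n-2}. of_real (et (k - 1)) * Dm k - of_real (et (k - 2)) * Dp k
         = of_real (\<epsilon> k) * A k * Ab k) \<and>
      (\<forall>k\<in>{2..n-2}. Dp k = Ab k / Ab (k - 1) * Dm (k - 1)))"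

text \<open>
  Over the complex numbers the momentum equations are algebraic once the real part is read as half
  the sum of \<open>D\<close> and its formal conjugate, where formal conjugation exchanges \<open>\<i>\<close> with \<open>-\<i>\<close> and
  \<open>a\<close> with \<open>1/a\<close>, hence \<open>A\<close> with \<open>Abar\<close>, and fixes the angular parameters.  This matches the
  definition of \<open>Abar\<close> itself, which is the complex conjugate of \<open>A\<close> for real angular parameters
  only.  The formal conjugates of \<open>D\<close> are further auxiliary variables subject to the conjugated
  equations.  The quotient equation for \<open>Dp\<close> is multiplied by its denominator, which is nonzero
  for real angular parameters.
\<close>

definition D_eqs ::
    "nat \<Rightarrow> (nat \<Rightarrow> real) \<Rightarrow> (nat \<Rightarrow> real) \<Rightarrow> (nat \<Rightarrow> complex) \<Rightarrow> (nat \<Rightarrow> complex)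
     \<Rightarrow> (nat \<Rightarrow> complex) \<Rightarrow> (nat \<Rightarrow> complex) \<Rightarrow> bool" where
  "D_eqs n \<epsilon> \<epsilon>t A Ab Dp Dm \<longleftrightarrow>
     (let et = ext0 \<epsilon> \<epsilon>t in
      Dm 1 = (Ab 1)\<^sup>2 \<and>
      (\<forall>k\<in>{2..n-2}. of_real (et (k - 1)) * Dm k - of_real (et (k - 2)) * Dp k
         = of_real (\<epsilon> k) * A k * Ab k) \<and>
      (\<forall>k\<in>{2..n-2}. Ab (k - 1) * Dp k = Ab k * Dm (k - 1)))"

definition momentum_eqs_alg ::
    "nat \<Rightarrow> real \<Rightarrow> (nat \<Rightarrow> real) \<Rightarrow> (nat \<Rightarrow> real) \<Rightarrow> (nat \<Rightarrow> complex)
     \<Rightarrow> (nat \<Rightarrow> complex) \<Rightarrow> (nat \<Rightarrow> complex) \<Rightarrow> (nat \<Rightarrow> complex) \<Rightarrow> (nat \<Rightarrow> complex)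
     \<Rightarrow> (nat \<Rightarrow> complex) \<Rightarrow> (nat \<Rightarrow> complex) \<Rightarrow> bool" where
  "momentum_eqs_alg n \<alpha> \<epsilon> \<epsilon>t w s st Dp Dm Dp' Dm' \<longleftrightarrow>
     (let sx = ext0 s st; A = A_of \<alpha> w s; Ab = Abar_of \<alpha> w s in
      vertex_eqs n \<epsilon> \<epsilon>t s st \<and>
      (\<forall>k\<in>{1..n-3}. (Dp (k + 1) + Dp' (k + 1)) / 2
         = - (s (k + 1) * sx (k - 1) + of_real (\<sigma> \<epsilon> \<epsilon>t (k + 1)))) \<and>
      D_eqs n \<epsilon> \<epsilon>t A Ab Dp Dm \<and> D_eqs n \<epsilon> \<epsilon>t Ab A Dp' Dm')"


section \<open>The two systems in terms of gradients of potentials\<close>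

definition accessory_system ::
    "nat \<Rightarrow> real \<Rightarrow> (nat \<Rightarrow> real) \<Rightarrow> (nat \<Rightarrow> real) \<Rightarrow> (nat \<Rightarrow> complex) \<Rightarrow> (nat \<Rightarrow> complex) \<Rightarrow> unit \<Rightarrow> bool" where
  "accessory_system n \<alpha> \<epsilon> \<epsilon>t z c _ \<longleftrightarrow> accessory_eqs n \<alpha> \<epsilon> \<epsilon>t z c"

definition momentum_system_alg ::
    "nat \<Rightarrow> real \<Rightarrow> (nat \<Rightarrow> real) \<Rightarrow> (nat \<Rightarrow> real) \<Rightarrow> (nat \<Rightarrow> complex) \<Rightarrow> (nat \<Rightarrow> complex)
     \<Rightarrow> (nat \<Rightarrow> complex) \<times> (nat \<Rightarrow> complex) \<times> (nat \<Rightarrow> complex) \<times> (nat \<Rightarrow> complex) \<times> (nat \<Rightarrow> complex)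
     \<Rightarrow> bool" where
  "momentum_system_alg n \<alpha> \<epsilon> \<epsilon>t w G B \<longleftrightarrow>
     (case B of (st, Dp, Dm, Dp', Dm') \<Rightarrow>
        momentum_eqs_alg n \<alpha> \<epsilon> \<epsilon>t w (angular \<alpha> \<epsilon> G) st Dp Dm Dp' Dm')"

definition momentum_system ::
    "nat \<Rightarrow> real \<Rightarrow> (nat \<Rightarrow> real) \<Rightarrow> (nat \<Rightarrow> real) \<Rightarrow> (nat \<Rightarrow> complex) \<Rightarrow> (nat \<Rightarrow> complex)
     \<Rightarrow> (nat \<Rightarrow> real) \<times> (nat \<Rightarrow> complex) \<times> (nat \<Rightarrow> complex) \<Rightarrow> bool" where
  "momentum_system n \<alpha> \<epsilon> \<epsilon>t w G B \<longleftrightarrow>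
     (case B of (st, Dp, Dm) \<Rightarrow>
        \<exists>s. (\<forall>k\<in>{1..n-2}. angular \<alpha> \<epsilon> G k = of_real (s k)) \<and>
            momentum_eqs n \<alpha> \<epsilon> \<epsilon>t w s st Dp Dm)"


section \<open>Consistency of the conventions\<close>

lemma a_of_w_of:
  assumes "z p \<noteq> 1"
  shows "a_of \<alpha> (w_of z) p = (1 - z p) powr of_real \<alpha>"
proof -
  have "- \<i> * of_real \<alpha> * (\<i> * Ln (1 - z p)) = of_real \<alpha> * Ln (1 - z p)"
    by (simp add: algebra_simps flip: mult.assoc)
  then show ?thesis using assms by (simp add: a_of_def w_of_def powr_def)
qed

lemma w_of_real:
  assumes "dist (z p) 1 = 1"
  shows "w_of z p \<in> \<real>"
proof -
  have "cmod (1 - z p) = 1" using assms by (simp add: dist_norm norm_minus_commute)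
  moreover from this have "1 - z p \<noteq> 0" by (metis norm_zero zero_neq_one)
  ultimately show ?thesis by (simp add: w_of_def complex_is_Real_iff)
qed

lemma cnj_A_of:
  assumes "w p \<in> \<real>" "s p \<in> \<real>"
  shows "cnj (A_of \<alpha> w s p) = Abar_of \<alpha> w s p" and "cnj (Abar_of \<alpha> w s p) = A_of \<alpha> w s p"
    and "Abar_of \<alpha> w s p \<noteq> 0"
proof -
  have w: "cnj (w p) = w p" and s: "cnj (s p) = s p" using assms by (auto simp: Reals_cnj_iff)
  have a: "cnj (a_of \<alpha> w p) = inverse (a_of \<alpha> w p)"
    by (simp add: a_of_def exp_cnj w flip: exp_minus)
  show 1: "cnj (A_of \<alpha> w s p) = Abar_of \<alpha> w s p"
    by (simp add: A_of_def Abar_of_def a s)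
  then show "cnj (Abar_of \<alpha> w s p) = A_of \<alpha> w s p" by (metis complex_cnj_cnj)
  have "1 - \<i> * s p \<noteq> 0" using assms(2) by (auto simp: complex_eq_iff elim!: Reals_cases)
  then show "Abar_of \<alpha> w s p \<noteq> 0" by (simp add: Abar_of_def a_of_def)
qed

text \<open>On real roots the algebraic form of the momentum equations is the verbatim one.\<close>

lemma momentum_eqs_iff_alg:
  assumes n: "n \<ge> 4" and w: "\<And>p. p \<in> {1..n-2} \<Longrightarrow> w p \<in> \<real>"
    and et0: "\<And>k. k \<in> {1..n-3} \<Longrightarrow> \<epsilon>t k > 0"
  shows "momentum_eqs n \<alpha> \<epsilon> \<epsilon>t w s st Dp Dm \<longleftrightarrow>
    (\<exists>Dp' Dm'. momentum_eqs_alg n \<alpha> \<epsilon> \<epsilon>t w (of_real \<circ> s) (of_real \<circ> st) Dp Dm Dp' Dm')"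
    (is "?L \<longleftrightarrow> ?R")
proof -
  define A where "A = A_of \<alpha> w (of_real \<circ> s)"
  define Ab where "Ab = Abar_of \<alpha> w (of_real \<circ> s)"
  define et where "et = ext0 \<epsilon> \<epsilon>t"
  define V where "V \<longleftrightarrow> vertex_eqs n \<epsilon> \<epsilon>t (of_real \<circ> s) (of_real \<circ> st)"
  have et: "et (k - 1) \<noteq> 0" if "k \<in> {2..n-2}" for k
    proof -
    have "k - 1 \<in> {1..n-3}" using that n by auto
    then show ?thesis using et0[of "k - 1"] by (auto simp: et_def ext0_def)
  qed
  have c: "cnj (A p) = Ab p" "cnj (Ab p) = A p" "Ab p \<noteq> 0" if "p \<in> {1..n-2}" for p
    using cnj_A_of[where w = w and p = p and s = "of_real \<circ> s" and \<alpha> = \<alpha>] w[OF that] by (auto simp: A_def Ab_def)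
  have A0: "A p \<noteq> 0" if "p \<in> {1..n-2}" for p
    using c[OF that] by auto
  have sx: "ext0 (of_real \<circ> s) (of_real \<circ> st) j = (of_real (ext0 s st j) :: complex)" for j
    by (simp add: ext0_def)
  have Lq: "D_eqs n \<epsilon> \<epsilon>t A Ab Dp Dm \<longleftrightarrow> Dm 1 = (Ab 1)\<^sup>2 \<and>
      (\<forall>k\<in>{2..n-2}. of_real (et (k - 1)) * Dm k - of_real (et (k - 2)) * Dp k
         = of_real (\<epsilon> k) * A k * Ab k) \<and>
      (\<forall>k\<in>{2..n-2}. Dp k = Ab k / Ab (k - 1) * Dm (k - 1))"
  proof -
    have "Ab (k - 1) * Dp k = Ab k * Dm (k - 1) \<longleftrightarrow> Dp k = Ab k / Ab (k - 1) * Dm (k - 1)"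
      if "k \<in> {2..n-2}" for k
    proof -
      have "k - 1 \<in> {1..n-2}" using that by auto
      then have "Ab (k - 1) \<noteq> 0" by (rule c(3))
      then show ?thesis by (simp add: field_simps)
    qed
    then show ?thesis by (auto simp: D_eqs_def et_def Let_def)
  qed
  have L: "?L \<longleftrightarrow> V \<and>
      (\<forall>k\<in>{1..n-3}. Re (Dp (k + 1)) = - (s (k + 1) * ext0 s st (k - 1) + \<sigma> \<epsilon> \<epsilon>t (k + 1))) \<and>
      D_eqs n \<epsilon> \<epsilon>t A Ab Dp Dm"
    unfolding Lq momentum_eqs_def Let_def V_def[symmetric] A_def[symmetric] Ab_def[symmetric]
      et_def[symmetric] by blast
  have R: "?R \<longleftrightarrow> V \<and> D_eqs n \<epsilon> \<epsilon>t A Ab Dp Dm \<and>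
      (\<exists>Dp' Dm'. D_eqs n \<epsilon> \<epsilon>t Ab A Dp' Dm' \<and>
      (\<forall>k\<in>{1..n-3}. (Dp (k + 1) + Dp' (k + 1)) / 2
         = of_real (- (s (k + 1) * ext0 s st (k - 1) + \<sigma> \<epsilon> \<epsilon>t (k + 1)))))"
    unfolding momentum_eqs_alg_def Let_def V_def[symmetric] A_def[symmetric] Ab_def[symmetric] sx
      comp_apply of_real_add[symmetric] of_real_mult[symmetric] of_real_minus[symmetric]
    by blast
  have half: "(x + cnj x) / 2 = of_real r \<longleftrightarrow> Re x = r" for x r
    by (simp add: complex_add_cnj)
  have conj_sol: "D_eqs n \<epsilon> \<epsilon>t Ab A (cnj \<circ> Dp) (cnj \<circ> Dm)" if D: "D_eqs n \<epsilon> \<epsilon>t A Ab Dp Dm"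
  proof -
    have "cnj (Dm 1) = (A 1)\<^sup>2" using D c[of 1] n by (simp add: D_eqs_def Let_def)
    moreover have "of_real (et (k - 1)) * cnj (Dm k) - of_real (et (k - 2)) * cnj (Dp k)
         = of_real (\<epsilon> k) * Ab k * A k" if k: "k \<in> {2..n-2}" for k
    proof -
      have "cnj (of_real (et (k - 1)) * Dm k - of_real (et (k - 2)) * Dp k)
           = cnj (of_real (\<epsilon> k) * A k * Ab k)"
        using D k by (simp add: D_eqs_def Let_def et_def)
      then show ?thesis using c[of k] k by simp
    qed
    moreover have "A (k - 1) * cnj (Dp k) = A k * cnj (Dm (k - 1))" if k: "k \<in> {2..n-2}" for k
    proof -
      have "cnj (Ab (k - 1) * Dp k) = cnj (Ab k * Dm (k - 1))"
        using D k by (simp add: D_eqs_def Let_def)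
      moreover have "k - 1 \<in> {1..n-2}" "k \<in> {1..n-2}" using k by auto
      ultimately show ?thesis using c by simp
    qed
    ultimately show ?thesis by (simp add: D_eqs_def Let_def et_def)
  qed
  have unique: "Dm1 k = Dm2 k \<and> (k \<ge> 2 \<longrightarrow> Dp1 k = Dp2 k)"
    if D1: "D_eqs n \<epsilon> \<epsilon>t Ab A Dp1 Dm1" and D2: "D_eqs n \<epsilon> \<epsilon>t Ab A Dp2 Dm2" and k: "k \<ge> 1" "k \<le> n - 2"
    for Dp1 Dm1 Dp2 Dm2 k
    using k
  proof (induction k rule: nat_induct_at_least)
    case base
    then show ?case using D1 D2 by (simp add: D_eqs_def Let_def)
  next
    case (Suc k)
    then have k: "Suc k \<in> {2..n-2}" and IH: "Dm1 k = Dm2 k" by auto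
    have step: "A k * Dp (Suc k) = A (Suc k) * Dm k"
      "of_real (et k) * Dm (Suc k) - of_real (et (Suc k - 2)) * Dp (Suc k)
        = of_real (\<epsilon> (Suc k)) * Ab (Suc k) * A (Suc k)"
      if D: "D_eqs n \<epsilon> \<epsilon>t Ab A Dp Dm" for Dp Dm
    proof -
      have "\<forall>k\<in>{2..n-2}. A (k - 1) * Dp k = A k * Dm (k - 1)"
        "\<forall>k\<in>{2..n-2}. of_real (et (k - 1)) * Dm k - of_real (et (k - 2)) * Dp k
          = of_real (\<epsilon> k) * Ab k * A k"
        using D unfolding D_eqs_def Let_def et_def by blast+
      from this[THEN bspec, OF k] show "A k * Dp (Suc k) = A (Suc k) * Dm k"
        "of_real (et k) * Dm (Suc k) - of_real (et (Suc k - 2)) * Dp (Suc k)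
          = of_real (\<epsilon> (Suc k)) * Ab (Suc k) * A (Suc k)"
        by (simp_all only: diff_Suc_1)
    qed
    have "A k * Dp1 (Suc k) = A k * Dp2 (Suc k)" using step(1)[OF D1] step(1)[OF D2] IH by simp
    then have p: "Dp1 (Suc k) = Dp2 (Suc k)" using A0[of k] k Suc.hyps by simp
    have "of_real (et k) * Dm1 (Suc k) - of_real (et (Suc k - 2)) * Dp1 (Suc k)
        = of_real (et k) * Dm2 (Suc k) - of_real (et (Suc k - 2)) * Dp2 (Suc k)"
      using step(2)[OF D1] step(2)[OF D2] by simp
    then have "of_real (et k) * Dm1 (Suc k) = of_real (et k) * Dm2 (Suc k)" using p by simp
    then have "Dm1 (Suc k) = Dm2 (Suc k)" using et[OF k] by simp
    with p show ?case by simp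
  qed
  show ?thesis
  proof
    assume l: ?L
    then have "\<forall>k\<in>{1..n-3}. (Dp (k + 1) + (cnj \<circ> Dp) (k + 1)) / 2
         = of_real (- (s (k + 1) * ext0 s st (k - 1) + \<sigma> \<epsilon> \<epsilon>t (k + 1)))"
      unfolding L comp_apply half by blast
    with l conj_sol show ?R unfolding L R by blast
  next
    assume r: ?R
    then obtain Dp' Dm' where D: "D_eqs n \<epsilon> \<epsilon>t A Ab Dp Dm" and D': "D_eqs n \<epsilon> \<epsilon>t Ab A Dp' Dm'"
      and h: "\<forall>k\<in>{1..n-3}. (Dp (k + 1) + Dp' (k + 1)) / 2
         = of_real (- (s (k + 1) * ext0 s st (k - 1) + \<sigma> \<epsilon> \<epsilon>t (k + 1)))"
      unfolding R by blast
    have "Dp' (k + 1) = cnj (Dp (k + 1))" if "k \<in> {1..n-3}" for k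
      using unique[OF D' conj_sol[OF D], of "k + 1"] that by auto
    then have "\<forall>k\<in>{1..n-3}. Re (Dp (k + 1)) = - (s (k + 1) * ext0 s st (k - 1) + \<sigma> \<epsilon> \<epsilon>t (k + 1))"
      using h unfolding half[symmetric] by simp
    with r D show ?L unfolding L R by blast
  qed
qed

end

theory Submission
  imports Defs "HOL-Computational_Algebra.Fundamental_Theorem_Algebra"
begin

text \<open>
  With \<open>X\<^sub>k = \<epsilon>\<^sub>1 Abar\<^sub>1 + \<epsilon>\<^sub>2 A\<^sub>2 + \<dots> + \<epsilon>\<^sub>k A\<^sub>k\<close> and its formal conjugate \<open>Y\<^sub>k\<close>, the vertex equations
  being given, both systems say \<open>X\<^sub>k Y\<^sub>k = \<epsilon>t\<^sup>2 (1 + st\<^sup>2)\<close> for the exchanged segment \<open>k - 1\<close>: the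
  recursion for \<open>D\<close> is solved by \<open>D\<^sup>-\<^sub>k = Abar\<^sub>k X\<^sub>k / \<epsilon>t\<close>, so that the real-part condition is the
  difference of two consecutive such equations, while up to the factor \<open>2\<pi>\<i>\<close> the integrals of type
  \<open>+-\<close> and \<open>-+\<close> are \<open>X\<close> and \<open>Y\<close>.

  A complex root exists because, after flipping the sign of \<open>s\<^sub>1\<close>, the differences read
  \<open>t\<^sub>k (\<Sum>\<^sub>j c\<^sub>j\<^sub>k t\<^sub>j + p\<^sub>k) + \<Sum>\<^sub>j q\<^sub>j\<^sub>k t\<^sub>j + r\<^sub>k = 0\<close> with \<open>j < k\<close>, and \<open>c\<^sub>j\<^sub>k \<noteq> 0\<close> as the points are
  distinct.  Solving for \<open>t\<^sub>k\<close> successively gives a rational curve parametrised by \<open>t\<^sub>1\<close>.  On it the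
  remaining linear form \<open>\<Sum>\<^sub>k \<epsilon>\<^sub>k t\<^sub>k\<close> is a nonconstant rational function with a pole at infinity, so
  its numerator has a root.  There all \<open>t\<^sub>k\<close> are finite, for the equations have no common zero at
  infinity.
\<close>

section \<open>Triangular quadratic systems\<close>

text \<open>A rational curve of solutions, in homogeneous coordinates with \<open>T 0\<close> as the denominator.\<close>

definition chain_param ::
    "(nat \<Rightarrow> nat \<Rightarrow> complex) \<Rightarrow> (nat \<Rightarrow> nat \<Rightarrow> complex) \<Rightarrow> (nat \<Rightarrow> complex) \<Rightarrow> (nat \<Rightarrow> complex)
     \<Rightarrow> nat \<Rightarrow> (nat \<Rightarrow> complex poly) \<Rightarrow> bool" where
  "chain_param c q p r m T \<longleftrightarrow> T 0 \<noteq> 0 \<and>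
     (\<forall>k\<in>{0..m} - {1}. degree (T k) < degree (T 1)) \<and>
     (\<forall>k\<in>{2..m}. T k * ((\<Sum>j=1..<k. smult (c j k) (T j)) + smult (p k) (T 0))
        + T 0 * ((\<Sum>j=1..<k. smult (q j k) (T j)) + smult (r k) (T 0)) = 0)"

text \<open>Only \<open>T 1\<close> reaches the top degree. With \<open>e 1\<close> nonzero this
  bounds the degree below by that of \<open>T 1\<close>, both for the coefficient of the next
  unknown and for the final linear form.\<close>

lemma degree_lead_sum:
  fixes T :: "nat \<Rightarrow> complex poly"
  assumes m: "m \<ge> 1" and d: "\<And>k. k \<in> {2..m} \<Longrightarrow> degree (T k) < degree (T 1)"
  shows "coeff (\<Sum>j=1..m. smult (e j) (T j)) (degree (T 1)) = e 1 * lead_coeff (T 1)"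
proof -
  have "coeff (T j) (degree (T 1)) = 0" if "j \<in> {2..m}" for j
    using d[OF that] by (simp add: coeff_eq_0)
  then have "(\<Sum>j=2..m. e j * coeff (T j) (degree (T 1))) = 0" by simp
  moreover have "{1..m} = insert 1 {2..m}" using m by auto
  ultimately show ?thesis by (simp add: coeff_sum)
qed

text \<open>Each equation is linear in its last unknown, so with homogenised coefficients
  \<open>\<beta>\<close> and \<open>\<gamma>\<close> it gives
  \<open>t\<^sub>k = - \<gamma> / \<beta>\<close>. As \<open>T 1\<close> dominates at infinity,
  \<open>c 1 k \<noteq> 0\<close> keeps \<open>\<beta>\<close> from being the zero
  polynomial.\<close>

lemma chain_param_exists:
  assumes c: "\<And>k. k \<in> {2..m} \<Longrightarrow> c 1 k \<noteq> 0" and m: "m \<ge> 1"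
  shows "\<exists>T. chain_param c q p r m T"
  using m c
proof (induction m rule: nat_induct_at_least)
  case base
  \<comment> \<open>No equation is present yet: \<open>t\<^sub>1\<close> is the free
    parameter.\<close>
  have "chain_param c q p r 1 (\<lambda>k. if k = 1 then [:0, 1:] else 1)"
    by (auto simp: chain_param_def)
  then show ?case by blast
next
  case (Suc m)
  then obtain T where T: "chain_param c q p r m T" by auto
  let ?k = "Suc m"
  have deg: "degree (T k) < degree (T 1)" if "k \<le> m" "k \<noteq> 1" for k
    using T that by (auto simp: chain_param_def)
  define \<beta> where "\<beta> = (\<Sum>j=1..m. smult (c j ?k) (T j)) + smult (p ?k) (T 0)"
  define \<gamma> where "\<gamma> = (\<Sum>j=1..m. smult (q j ?k) (T j)) + smult (r ?k) (T 0)"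
  \<comment> \<open>The denominator of \<open>- \<gamma> / \<beta>\<close> is cleared: the old
    coordinates are multiplied by \<open>\<beta>\<close>, and the new one must have quotient
    \<open>- \<gamma> / \<beta>\<close> by \<open>T' 0 = \<beta> * T 0\<close>.\<close>
  define T' where "T' = (\<lambda>j. if j \<le> m then \<beta> * T j else - T 0 * \<gamma>)"
  have d0: "degree (T 0) < degree (T 1)" using deg[of 0] Suc.hyps by simp
  have T1: "T 1 \<noteq> 0" using d0 by auto
  have degle: "degree (T j) \<le> degree (T 1)" if "j \<le> m" for j
    using deg[OF that] by (cases "j = 1") auto
  have "degree (\<Sum>j=1..m. smult (q j ?k) (T j)) \<le> degree (T 1)"
    by (rule degree_sum_le) (auto intro: order_trans[OF degree_smult_le] degle[unfolded One_nat_def])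
  then have g: "degree \<gamma> \<le> degree (T 1)"
    unfolding \<gamma>_def using d0 by (intro degree_add_le) (auto intro: order_trans[OF degree_smult_le])
  have "coeff \<beta> (degree (T 1)) = c 1 ?k * lead_coeff (T 1)"
    unfolding \<beta>_def using degree_lead_sum[of m T "\<lambda>j. c j ?k"] Suc.hyps Suc.prems[of ?k] deg d0
    by (simp add: coeff_eq_0)
  then have "coeff \<beta> (degree (T 1)) \<noteq> 0" using T1 Suc.prems[of ?k] Suc.hyps by simp
  then have b: "degree (T 1) \<le> degree \<beta>" and b0: "\<beta> \<noteq> 0" by (auto intro: le_degree)
  have d1: "degree (T' 1) = degree \<beta> + degree (T 1)"
    using Suc.hyps b0 T1 by (simp add: T'_def degree_mult_eq)
  have "degree (T' k) < degree (T' 1)" if k: "k \<in> {0..?k} - {1}" for k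
  proof (cases "k \<le> m")
    case True
    then have "degree (T' k) \<le> degree \<beta> + degree (T k)"
      by (simp add: T'_def degree_mult_le)
    with deg[of k] True k d1 show ?thesis by auto
  next
    case False
    \<comment> \<open>The new coordinate stays below \<open>T' 1\<close>, as
      \<open>degree (T 0) < degree (T 1) \<le> degree \<beta>\<close> and
      \<open>degree \<gamma> \<le> degree (T 1)\<close>.\<close>
    then have "degree (T' k) \<le> degree (T 0) + degree \<gamma>"
      using degree_mult_le[of "T 0" \<gamma>] by (simp add: T'_def)
    with d0 g b d1 show ?thesis by linarith
  qed
  moreover have "T' 0 \<noteq> 0" using b0 T by (simp add: T'_def chain_param_def)
  moreover have "T' k * ((\<Sum>j=1..<k. smult (c j k) (T' j)) + smult (p k) (T' 0))
        + T' 0 * ((\<Sum>j=1..<k. smult (q j k) (T' j)) + smult (r k) (T' 0)) = 0"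
    if k: "k \<in> {2..?k}" for k
  proof -
    have sums: "(\<Sum>j=1..<k. smult (h j) (T' j)) = \<beta> * (\<Sum>j=1..<k. smult (h j) (T j))" for h
      unfolding sum_distrib_left using k by (intro sum.cong) (auto simp: T'_def)
    have *: "(\<Sum>j=1..<k. smult (h j) (T' j)) + smult x (T' 0)
        = \<beta> * ((\<Sum>j=1..<k. smult (h j) (T j)) + smult x (T 0))" for h x
      unfolding sums by (simp add: T'_def algebra_simps)
    show ?thesis
    proof (cases "k = ?k")
      case True
      then have "{1..<k} = {1..m}" by auto
      then have "(\<Sum>j=1..<k. smult (c j k) (T j)) + smult (p k) (T 0) = \<beta>"
        "(\<Sum>j=1..<k. smult (q j k) (T j)) + smult (r k) (T 0) = \<gamma>"
        using True by (simp_all add: \<beta>_def \<gamma>_def)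
      then show ?thesis unfolding * using True by (simp add: T'_def algebra_simps)
    next
      case False
      then have km: "k \<in> {2..m}" using k by auto
      define B where "B = (\<Sum>j=1..<k. smult (c j k) (T j)) + smult (p k) (T 0)"
      define G where "G = (\<Sum>j=1..<k. smult (q j k) (T j)) + smult (r k) (T 0)"
      have "T k * B + T 0 * G = 0" using T km unfolding chain_param_def B_def G_def by blast
      \<comment> \<open>The equations are homogeneous of degree two in \<open>T\<close>, so scaling
        by \<open>\<beta>\<close> multiplies them by its square.\<close>
      then have "\<beta>\<^sup>2 * (T k * B + T 0 * G) = 0" by simp
      then show ?thesis unfolding * B_def[symmetric] G_def[symmetric] using km
        by (simp add: T'_def algebra_simps power2_eq_square)
    qed
  qed
  ultimately have "chain_param c q p r ?k T'" unfolding chain_param_def by blast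
  then show ?case by blast
qed

text \<open>The leading forms of the equations allow at most one nonzero \<open>\<tau>\<close>; the linear form excludes it.\<close>

lemma no_root_at_infinity:
  fixes \<tau> :: "nat \<Rightarrow> complex"
  assumes c: "\<And>j k. 1 \<le> j \<Longrightarrow> j < k \<Longrightarrow> k \<le> m \<Longrightarrow> c j k \<noteq> 0"
    and e: "\<And>j. j \<in> {1..m} \<Longrightarrow> e j \<noteq> 0"
    and eq: "\<And>k. k \<in> {2..m} \<Longrightarrow> \<tau> k * (\<Sum>j=1..<k. c j k * \<tau> j) = 0"
    and lin: "(\<Sum>j=1..m. e j * \<tau> j) = 0"
    and j: "j \<in> {1..m}"
  shows "\<tau> j = 0"
proof (rule ccontr)
  assume "\<tau> j \<noteq> 0"
  define i where "i = (LEAST i. i \<in> {1..m} \<and> \<tau> i \<noteq> 0)"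
  have i: "i \<in> {1..m}" "\<tau> i \<noteq> 0"
    using LeastI[of "\<lambda>i. i \<in> {1..m} \<and> \<tau> i \<noteq> 0" j] \<open>\<tau> j \<noteq> 0\<close> j by (auto simp: i_def)
  have below: "\<tau> k = 0" if "k \<in> {1..<i}" for k
    using not_less_Least[of k "\<lambda>i. i \<in> {1..m} \<and> \<tau> i \<noteq> 0"] that i(1) by (auto simp: i_def)
  \<comment> \<open>In equation \<open>k\<close> all terms but \<open>j = i\<close> vanish, by
    minimality of \<open>i\<close> below and by induction above, leaving
    \<open>\<tau> k * c i k * \<tau> i = 0\<close>. Afterwards the linear form reduces to
    \<open>e i * \<tau> i\<close>.\<close>
  have above: "\<tau> k = 0" if "i < k" "k \<le> m" for k
    using that
  proof (induction k rule: less_induct)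
    case (less k)
    have "(\<Sum>j=1..<k. c j k * \<tau> j) = (\<Sum>j\<in>{i}. c j k * \<tau> j)"
    proof (rule sum.mono_neutral_right)
      show "\<forall>j\<in>{1..<k} - {i}. c j k * \<tau> j = 0"
      proof
        fix j assume "j \<in> {1..<k} - {i}"
        then have "\<tau> j = 0" using below[of j] less.IH[of j] less.prems by (cases "j < i") auto
        then show "c j k * \<tau> j = 0" by simp
      qed
    qed (use less.prems i in auto)
    moreover have "k \<in> {2..m}" using less.prems i by auto
    ultimately show ?case using eq[of k] c[of i k] i less.prems by auto
  qed
  have "(\<Sum>j=1..m. e j * \<tau> j) = (\<Sum>j\<in>{i}. e j * \<tau> j)"
  proof (rule sum.mono_neutral_right)
    show "\<forall>j\<in>{1..m} - {i}. e j * \<tau> j = 0"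
    proof
      fix j assume "j \<in> {1..m} - {i}"
      then have "\<tau> j = 0" using below[of j] above[of j] by (cases "j < i") auto
      then show "e j * \<tau> j = 0" by simp
    qed
  qed (use i in auto)
  with lin e[of i] i show False by simp
qed

text \<open>The linear form restricted to the curve is a nonconstant polynomial and so has a zero
  \<open>x\<close>. If \<open>T 0\<close> vanished there, \<open>no_root_at_infinity\<close> would
  make all coordinates vanish at \<open>x\<close>, against minimality of the degree.\<close>

lemma chain_root_exists:
  fixes c q :: "nat \<Rightarrow> nat \<Rightarrow> complex" and p r e :: "nat \<Rightarrow> complex"
  assumes c: "\<And>j k. 1 \<le> j \<Longrightarrow> j < k \<Longrightarrow> k \<le> m \<Longrightarrow> c j k \<noteq> 0"
    and e: "\<And>j. j \<in> {1..m} \<Longrightarrow> e j \<noteq> 0" and m: "m \<ge> 1"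
  shows "\<exists>t. (\<Sum>j=1..m. e j * t j) = 0 \<and>
    (\<forall>k\<in>{2..m}. t k * ((\<Sum>j=1..<k. c j k * t j) + p k) + ((\<Sum>j=1..<k. q j k * t j) + r k) = 0)"
proof -
  \<comment> \<open>Least degree makes the homogeneous coordinates free of common zeros.\<close>
  obtain T where T: "chain_param c q p r m T"
    and least: "\<And>T'. chain_param c q p r m T' \<Longrightarrow> degree (T 1) \<le> degree (T' 1)"
    using chain_param_exists[of m c q p r] c m
      ex_has_least_nat[of "chain_param c q p r m" _ "\<lambda>T. degree (T 1)"] by fastforce
  have deg: "degree (T k) < degree (T 1)" if "k \<le> m" "k \<noteq> 1" for k
    using T that by (auto simp: chain_param_def)
  have d1: "degree (T 1) > 0" using deg[of 0] by simp
  define L where "L = (\<Sum>j=1..m. smult (e j) (T j))"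
  have "coeff L (degree (T 1)) = e 1 * lead_coeff (T 1)"
    unfolding L_def using m e[of 1] deg by (intro degree_lead_sum) auto
  moreover have "T 1 \<noteq> 0" using d1 by auto
  ultimately have "degree (T 1) \<le> degree L" using e[of 1] m by (intro le_degree) auto
  then have "\<not> constant (poly L)" using d1 by (simp add: constant_degree)
  then obtain x where x: "poly L x = 0" using fundamental_theorem_of_algebra by blast
  have eqx: "poly (T k) x * ((\<Sum>j=1..<k. c j k * poly (T j) x) + p k * poly (T 0) x)
      + poly (T 0) x * ((\<Sum>j=1..<k. q j k * poly (T j) x) + r k * poly (T 0) x) = 0"
    if k: "k \<in> {2..m}" for k
  proof -
    have "T k * ((\<Sum>j=1..<k. smult (c j k) (T j)) + smult (p k) (T 0))
        + T 0 * ((\<Sum>j=1..<k. smult (q j k) (T j)) + smult (r k) (T 0)) = 0"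
      using T k unfolding chain_param_def by blast
    from arg_cong[OF this, of "\<lambda>P. poly P x"] show ?thesis by (simp add: poly_sum)
  qed
  have linx: "(\<Sum>j=1..m. e j * poly (T j) x) = 0" using x by (simp add: L_def poly_sum)
  have T0x: "poly (T 0) x \<noteq> 0"
  proof
    assume 0: "poly (T 0) x = 0"
    \<comment> \<open>With \<open>T 0\<close> zero at \<open>x\<close>, only the leading forms
      survive in \<open>eqx\<close>.\<close>
    have "poly (T j) x = 0" if "j \<in> {1..m}" for j
      using c e _ linx that by (rule no_root_at_infinity) (use eqx 0 in auto)
    with 0 have "\<forall>j\<in>{0..m}. [:-x, 1:] dvd T j"
      by (metis One_nat_def Suc_leI atLeastAtMost_iff le0 not_gr_zero poly_eq_0_iff_dvd)
    then have "\<forall>j\<in>{0..m}. \<exists>R. T j = [:-x, 1:] * R" by (auto simp: dvd_def)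
    \<comment> \<open>The common factor cancels from the homogeneous equations, so \<open>T'\<close>
      is again a parametrisation, with \<open>degree (T' 1)\<close> smaller by one.\<close>
    then obtain T' where T': "\<And>j. j \<in> {0..m} \<Longrightarrow> T j = [:-x, 1:] * T' j" by metis
    have T0: "T' 0 \<noteq> 0" using T T'[of 0] by (auto simp: chain_param_def)
    have dT: "degree (T j) = Suc (degree (T' j))" if "j \<in> {0..m}" "T' j \<noteq> 0" for j
      unfolding T'[OF that(1)] using that(2) by (subst degree_mult_eq) auto
    have T1: "T' 1 \<noteq> 0" using T'[of 1] d1 m by auto
    have "degree (T' k) < degree (T' 1)" if k: "k \<in> {0..m} - {1}" for k
    proof (cases "T' k = 0")
      \<comment> \<open>The zero polynomial has degree 0, so \<open>degree (T' 1)\<close> has to be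
        positive. It is, because \<open>T 0\<close> has the factor too and hence
        \<open>1 \<le> degree (T 0) < degree (T 1)\<close>.\<close>
      case True
      then show ?thesis using deg[of 0] dT[of 0] dT[of 1] T0 T1 m by auto
    next
      case False
      then show ?thesis using deg[of k] dT[of k] dT[of 1] T1 m k by auto
    qed
    moreover have "T' k * ((\<Sum>j=1..<k. smult (c j k) (T' j)) + smult (p k) (T' 0))
        + T' 0 * ((\<Sum>j=1..<k. smult (q j k) (T' j)) + smult (r k) (T' 0)) = 0"
      if k: "k \<in> {2..m}" for k
    proof -
      let ?X = "[:-x, 1:]"
      have "(\<Sum>j=1..<k. smult (h j) (T j)) = ?X * (\<Sum>j=1..<k. smult (h j) (T' j))" for h
        unfolding sum_distrib_left
        by (rule sum.cong) (use k T' in auto)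
      then have *: "(\<Sum>j=1..<k. smult (h j) (T j)) + smult y (T 0)
          = ?X * ((\<Sum>j=1..<k. smult (h j) (T' j)) + smult y (T' 0))" for h y
        using T'[of 0] by (simp only: distrib_left mult_smult_right) simp
      define B where "B = (\<Sum>j=1..<k. smult (c j k) (T' j)) + smult (p k) (T' 0)"
      define G where "G = (\<Sum>j=1..<k. smult (q j k) (T' j)) + smult (r k) (T' 0)"
      have "T k * ((\<Sum>j=1..<k. smult (c j k) (T j)) + smult (p k) (T 0))
        + T 0 * ((\<Sum>j=1..<k. smult (q j k) (T j)) + smult (r k) (T 0)) = 0"
        using T k unfolding chain_param_def by blast
      then have "(?X * T' k) * (?X * B) + (?X * T' 0) * (?X * G) = 0"
        unfolding * B_def[symmetric] G_def[symmetric] using T'[of k] T'[of 0] k by simp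
      moreover have "(?X * T' k) * (?X * B) + (?X * T' 0) * (?X * G)
          = ?X\<^sup>2 * (T' k * B + T' 0 * G)"
        by (simp only: algebra_simps power2_eq_square)
      moreover have "?X\<^sup>2 \<noteq> 0" by simp
      ultimately have "T' k * B + T' 0 * G = 0" by (metis mult_eq_0_iff)
      then show ?thesis by (simp add: B_def G_def)
    qed
    ultimately have "chain_param c q p r m T'" using T0 unfolding chain_param_def by blast
    from least[OF this] dT[of 1] T1 m show False by simp
  qed
  define X where "X = (\<lambda>j. poly (T j) x)"
  define t where "t = (\<lambda>j. X j / X 0)"
  have X0: "X 0 \<noteq> 0" and Xt: "X j = t j * X 0" for j using T0x by (simp_all add: X_def t_def)
  have s: "(\<Sum>j\<in>J. h j * X j) = (\<Sum>j\<in>J. h j * t j) * X 0" for h J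
    by (simp add: t_def sum_distrib_right X0)
  have "(\<Sum>j=1..m. e j * t j) = 0"
    using linx s[of e "{1..m}"] X0 by (simp add: X_def)
  moreover have "t k * ((\<Sum>j=1..<k. c j k * t j) + p k) + ((\<Sum>j=1..<k. q j k * t j) + r k) = 0"
    if k: "k \<in> {2..m}" for k
  proof -
    have "X k * ((\<Sum>j=1..<k. c j k * X j) + p k * X 0)
      + X 0 * ((\<Sum>j=1..<k. q j k * X j) + r k * X 0) = 0" using eqx[OF k] by (simp add: X_def)
    then have "(X 0)\<^sup>2 * (t k * ((\<Sum>j=1..<k. c j k * t j) + p k) + ((\<Sum>j=1..<k. q j k * t j) + r k)) = 0"
      unfolding s Xt[of k] by (simp add: algebra_simps power2_eq_square)
    then show ?thesis using X0 by simp
  qed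
  ultimately show ?thesis by blast
qed

section \<open>Potentials with prescribed gradients\<close>

lemma has_field_derivative_separable_sum:
  fixes g :: "nat \<Rightarrow> complex \<Rightarrow> complex"
  assumes "finite K" "k \<in> K" and g: "(g k has_field_derivative D) (at t)"
  shows "((\<lambda>t. \<Sum>j\<in>K. g j ((\<xi>(k := t)) j)) has_field_derivative D) (at t)"
proof -
  have "(\<Sum>j\<in>K. g j ((\<xi>(k := t)) j)) = g k t + (\<Sum>j\<in>K-{k}. g j (\<xi> j))" for t
    using assms(1,2) by (simp add: sum.remove)
  then show ?thesis using DERIV_add[OF g DERIV_const] by simp
qed

lemma exp_w_of: "z p \<noteq> 1 \<Longrightarrow> exp (- \<i> * w_of z p) = 1 - z p"
  by (simp add: w_of_def flip: mult.assoc)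

text \<open>
  Defining the action by composing the block with the entire map \<open>y \<mapsto> 1 - exp (-\<i> * y)\<close> avoids the
  branch cut of the logarithm, which meets the circle at \<open>z = 2\<close>.
\<close>

lemma potentials_exist:
  fixes c :: "nat \<Rightarrow> complex"
  assumes z: "\<And>k. k \<in> {1..n-2} \<Longrightarrow> dist (z k) 1 = 1"
  obtains f S where
    "holomorphic_potential_at (n - 2) f z" "holomorphic_potential_at (n - 2) S (w_of z)"
    "potentials_related n \<epsilon> z f S"
    "\<And>k. k \<in> {1..n-2} \<Longrightarrow> partial_deriv f z k = c k"
    "\<And>k. k \<in> {1..n-2} \<Longrightarrow>
       partial_deriv S (w_of z) k = \<i> * (c k * (1 - z k) - of_real (\<epsilon> k))"
proof
  \<comment> \<open>Only the gradient at one point is prescribed, so a linear block suffices. The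
    relation of potentials then dictates the summands \<open>h\<close> of the action.\<close>
  define g where "g = (\<lambda>k t. c k * t)"
  define h where "h = (\<lambda>k t. c k * (1 - exp (- \<i> * t)) - \<i> * of_real (\<epsilon> k) * t)"
  let ?f = "\<lambda>\<zeta>. \<Sum>k=1..n-2. g k (\<zeta> k)" and ?S = "\<lambda>y. \<Sum>k=1..n-2. h k (y k)"
  have dg: "(g k has_field_derivative c k) (at t)" for k t
    unfolding g_def by (auto intro!: derivative_eq_intros)
  have dh: "(h k has_field_derivative \<i> * (c k * exp (- \<i> * t) - of_real (\<epsilon> k))) (at t)" for k t
    unfolding h_def by (auto intro!: derivative_eq_intros simp: algebra_simps)
  note df = has_field_derivative_separable_sum[where g = g, OF finite_atLeastAtMost _ dg]
    and dS = has_field_derivative_separable_sum[where g = h, OF finite_atLeastAtMost _ dh]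
  show "holomorphic_potential_at (n - 2) ?f z"
    unfolding holomorphic_potential_at_def field_differentiable_def
    using df by (intro exI[of _ "1::real"] conjI zero_less_one) blast
  show "holomorphic_potential_at (n - 2) ?S (w_of z)"
    unfolding holomorphic_potential_at_def field_differentiable_def
    using dS by (intro exI[of _ "1::real"] conjI zero_less_one) blast
  have "z k \<noteq> 1" if "k \<in> {1..n-2}" for k using z[OF that] by auto
  then show "partial_deriv ?f z k = c k"
    "partial_deriv ?S (w_of z) k = \<i> * (c k * (1 - z k) - of_real (\<epsilon> k))" if "k \<in> {1..n-2}" for k
    unfolding partial_deriv_def
    using DERIV_imp_deriv[OF df[OF that]] DERIV_imp_deriv[OF dS[OF that]] exp_w_of[of z k] that
    by auto
  \<comment> \<open>Radius 1 keeps every coordinate of \<open>\<zeta>\<close> away from 1, since the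
    given points have distance exactly 1 from it.\<close>
  have "?f \<zeta> = ?S (w_of \<zeta>) + \<i> * (\<Sum>k=1..n-2. of_real (\<epsilon> k) * w_of \<zeta> k)"
    if "near (n - 2) 1 z \<zeta>" for \<zeta>
  proof -
    have "g k (\<zeta> k) = h k (w_of \<zeta> k) + \<i> * (of_real (\<epsilon> k) * w_of \<zeta> k)" if k: "k \<in> {1..n-2}" for k
    proof -
      have "dist (\<zeta> k) (z k) < 1" using \<open>near (n - 2) 1 z \<zeta>\<close> k by (auto simp: near_def)
      then have "\<zeta> k \<noteq> 1" using z[OF k] by (auto simp: dist_commute)
      then have "exp (- \<i> * w_of \<zeta> k) = 1 - \<zeta> k" by (rule exp_w_of)
      then show ?thesis unfolding g_def h_def by (simp only:) (simp add: algebra_simps)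
    qed
    then show ?thesis by (simp add: sum_distrib_left flip: sum.distrib)
  qed
  then show "potentials_related n \<epsilon> z ?f ?S"
    unfolding potentials_related_def using zero_less_one by blast
qed

text \<open>
  One-sided agreement is all that is available at \<open>z = 2\<close>, where \<open>w_of\<close> jumps.
\<close>

lemma deriv_eq_if_eq_on_right:
  fixes g h :: "complex \<Rightarrow> complex"
  assumes g: "(g has_field_derivative D) (at w)" and h: "(h has_field_derivative E) (at w)"
    and \<delta>: "\<delta> > 0" and eq: "\<And>x::real. 0 \<le> x \<Longrightarrow> x < \<delta> \<Longrightarrow> g (w + of_real x) = h (w + of_real x)"
  shows "D = E"
proof -
  \<comment> \<open>Along the real direction a complex derivative becomes a vector derivative on
    \<open>{0..<\<delta>}\<close>, unique there because 0 is a limit point of the interval.\<close>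
  have d: "((\<lambda>x::real. F (w + of_real x)) has_vector_derivative F') (at 0 within {0..<\<delta>})"
    if "(F has_field_derivative F') (at w)" for F F'
  proof -
    have "((\<lambda>x::real. w + of_real x) has_vector_derivative 1) (at 0 within {0..<\<delta>})"
      by (auto intro!: derivative_eq_intros)
    from field_vector_diff_chain_within[OF this, of F F'] that show ?thesis
      by (simp add: o_def has_field_derivative_at_within)
  qed
  have "((\<lambda>x::real. g (w + of_real x)) has_vector_derivative E) (at 0 within {0..<\<delta>})"
    by (rule has_vector_derivative_transform[OF _ _ d[OF h]]) (use \<delta> eq in auto)
  from vector_derivative_unique_within[OF _ d[OF g] this] \<delta> show ?thesis
    by (simp add: trivial_limit_within islimpt_Ico)
qed

text \<open>The relation of potentials is differentiated along \<open>?\<zeta> t\<close>, which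
  moves only coordinate \<open>k\<close> and there inverts \<open>w_of\<close>. Both sides agree for
  real increments \<open>x \<ge> 0\<close>, which is enough by
  \<open>deriv_eq_if_eq_on_right\<close>.\<close>

lemma gradient_relation:
  assumes f: "holomorphic_potential_at (n - 2) f z"
    and S: "holomorphic_potential_at (n - 2) S (w_of z)"
    and rel: "potentials_related n \<epsilon> z f S" and k: "k \<in> {1..n-2}" and zk: "z k \<noteq> 1"
  shows "partial_deriv f z k * (1 - z k)
    = of_real (\<epsilon> k) - \<i> * partial_deriv S (w_of z) k"
proof -
  let ?w = "w_of z k" and ?G = "partial_deriv S (w_of z) k"
  let ?\<zeta> = "\<lambda>t. z(k := 1 - exp (- \<i> * t))"
  have near_refl: "near m \<delta> x x" if "\<delta> > 0" for m \<delta> x using that by (simp add: near_def)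
  have fd: "(\<lambda>t. f (z(k := t))) field_differentiable at (z k)"
    and Sd: "(\<lambda>t. S ((w_of z)(k := t))) field_differentiable at ?w"
    using f S k near_refl unfolding holomorphic_potential_at_def by blast+
  have "((\<lambda>t. f (z(k := t))) has_field_derivative partial_deriv f z k) (at (1 - exp (- \<i> * ?w)))"
    using fd exp_w_of[of z k, OF zk] by (simp add: partial_deriv_def DERIV_deriv_iff_field_differentiable)
  moreover have "((\<lambda>t. 1 - exp (- \<i> * t)) has_field_derivative \<i> * (1 - z k)) (at ?w)"
    using exp_w_of[of z k, OF zk] by (auto intro!: derivative_eq_intros)
  ultimately have g: "((\<lambda>t. f (?\<zeta> t)) has_field_derivative partial_deriv f z k * (\<i> * (1 - z k))) (at ?w)"
    by (rule DERIV_chain2)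
  have e: "((\<lambda>t. \<Sum>j=1..n-2. of_real (\<epsilon> j) * ((w_of z)(k := t)) j) has_field_derivative of_real (\<epsilon> k)) (at ?w)"
    by (rule has_field_derivative_separable_sum[where g = "\<lambda>j t. of_real (\<epsilon> j) * t"])
      (use k in \<open>auto intro!: derivative_eq_intros\<close>)
  have h: "((\<lambda>t. S ((w_of z)(k := t)) + \<i> * (\<Sum>j=1..n-2. of_real (\<epsilon> j) * ((w_of z)(k := t)) j))
     has_field_derivative ?G + \<i> * of_real (\<epsilon> k)) (at ?w)"
    using Sd by (intro DERIV_add DERIV_cmult e)
      (simp add: partial_deriv_def DERIV_deriv_iff_field_differentiable)
  obtain \<delta> where \<delta>: "\<delta> > 0" and R: "\<And>\<zeta>. near (n - 2) \<delta> z \<zeta> \<Longrightarrow>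
      f \<zeta> = S (w_of \<zeta>) + \<i> * (\<Sum>k=1..n-2. of_real (\<epsilon> k) * w_of \<zeta> k)"
    using rel unfolding potentials_related_def by blast
  \<comment> \<open>The argument lies in \<open>(- pi, pi]\<close>, so \<open>Re ?w\<close> may
    equal \<open>- pi\<close> but never \<open>pi\<close>. A small step to the right stays where
    \<open>Ln\<close> inverts \<open>exp\<close>; a step to the left may not.\<close>
  have w: "- pi \<le> Re ?w" "Re ?w < pi"
    using mpi_less_Im_Ln[of "1 - z k"] Im_Ln_le_pi[of "1 - z k"] zk by (auto simp: w_of_def)
  have "isCont (\<lambda>t. 1 - exp (- \<i> * t)) ?w" by (intro continuous_intros)
  then obtain \<eta> where \<eta>: "\<eta> > 0"
    "\<And>t. dist t ?w < \<eta> \<Longrightarrow> dist (1 - exp (- \<i> * t)) (z k) < \<delta>"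
    using \<delta> exp_w_of[of z k, OF zk] unfolding continuous_at_eps_delta by (metis diff_diff_eq2 add_diff_cancel_left')
  have "f (?\<zeta> t) = S ((w_of z)(k := t)) + \<i> * (\<Sum>j=1..n-2. of_real (\<epsilon> j) * ((w_of z)(k := t)) j)"
    if x: "0 \<le> x" "x < min \<eta> (pi - Re ?w)" and t: "t = ?w + of_real x" for t and x :: real
  proof -
    have "near (n - 2) \<delta> z (?\<zeta> t)"
      using \<eta>(2)[of t] x \<delta> by (auto simp: near_def t dist_norm)
    moreover have "w_of (?\<zeta> t) = (w_of z)(k := t)"
    proof -
      have "Ln (exp (- \<i> * t)) = - \<i> * t" using w x by (intro Ln_exp) (auto simp: t)
      then have "\<i> * Ln (exp (- \<i> * t)) = t" by (simp flip: mult.assoc)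
      then show ?thesis by (auto simp: fun_eq_iff w_of_def)
    qed
    ultimately show ?thesis using R by metis
  qed
  then have "partial_deriv f z k * (\<i> * (1 - z k)) = ?G + \<i> * of_real (\<epsilon> k)"
    using \<eta>(1) w(2) by (intro deriv_eq_if_eq_on_right[OF g h, of "min \<eta> (pi - Re ?w)"]) auto
  then have "- \<i> * (partial_deriv f z k * (\<i> * (1 - z k))) = - \<i> * (?G + \<i> * of_real (\<epsilon> k))" by simp
  then show ?thesis by (simp add: algebra_simps)
qed

section \<open>Elimination of the auxiliary variables\<close>

text \<open>The exceptional first summand reflects the opposite direction of the first segment.\<close>

definition partial_momentum ::
    "(nat \<Rightarrow> real) \<Rightarrow> (nat \<Rightarrow> complex) \<Rightarrow> (nat \<Rightarrow> complex) \<Rightarrow> nat \<Rightarrow> complex" where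
  "partial_momentum \<epsilon> A Ab k = (\<Sum>i=1..k. of_real (\<epsilon> i) * (if i = 1 then Ab 1 else A i))"

lemma partial_momentum_Suc:
  "k \<ge> 1 \<Longrightarrow> partial_momentum \<epsilon> A Ab (Suc k) = partial_momentum \<epsilon> A Ab k + of_real (\<epsilon> (Suc k)) * A (Suc k)"
  by (simp add: partial_momentum_def)

lemma partial_momentum_1: "partial_momentum \<epsilon> A Ab 1 = of_real (\<epsilon> 1) * Ab 1"
  by (simp add: partial_momentum_def)

lemma partial_momentum_split:
  "k \<ge> 1 \<Longrightarrow> partial_momentum \<epsilon> A Ab k = of_real (\<epsilon> 1) * Ab 1 + (\<Sum>i=2..k. of_real (\<epsilon> i) * A i)"
proof (induction k rule: nat_induct_at_least)
  case base
  then show ?case by (simp add: partial_momentum_1[unfolded One_nat_def])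
next
  case (Suc k)
  then show ?case by (simp add: partial_momentum_Suc)
qed

lemma ext0_nonzero:
  assumes "n \<ge> 4" "\<And>k. k \<in> {1..n-2} \<Longrightarrow> \<epsilon> k > (0::real)" "\<And>k. k \<in> {1..n-3} \<Longrightarrow> \<epsilon>t k > 0"
    and "k \<le> n - 3"
  shows "ext0 \<epsilon> \<epsilon>t k \<noteq> 0"
proof -
  have "1 \<in> {1..n-2}" using assms(1) by auto
  then show ?thesis using assms(2)[of 1] assms(3)[of k] assms(4) by (cases "k = 0") (auto simp: ext0_def)
qed

text \<open>Consecutive partial momenta differ by one summand, which yields the difference equation.
  The explicit formula does not divide by \<open>Ab\<close>, so it also covers complex roots at
  which some \<open>Ab k\<close> vanishes.\<close>

lemma D_eqs_solution:
  assumes et: "\<And>k. k \<le> n - 3 \<Longrightarrow> ext0 \<epsilon> \<epsilon>t k \<noteq> 0" and n: "n \<ge> 4"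
  shows "D_eqs n \<epsilon> \<epsilon>t A Ab
    (\<lambda>k. Ab k * partial_momentum \<epsilon> A Ab (k - 1) / of_real (ext0 \<epsilon> \<epsilon>t (k - 2)))
    (\<lambda>k. Ab k * partial_momentum \<epsilon> A Ab k / of_real (ext0 \<epsilon> \<epsilon>t (k - 1)))"
proof -
  have "of_real (ext0 \<epsilon> \<epsilon>t (k - 1)) * (Ab k * partial_momentum \<epsilon> A Ab k / of_real (ext0 \<epsilon> \<epsilon>t (k - 1)))
      - of_real (ext0 \<epsilon> \<epsilon>t (k - 2)) * (Ab k * partial_momentum \<epsilon> A Ab (k - 1) / of_real (ext0 \<epsilon> \<epsilon>t (k - 2)))
      = of_real (\<epsilon> k) * A k * Ab k" if k: "k \<in> {2..n-2}" for k
  proof -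
    have "partial_momentum \<epsilon> A Ab k = partial_momentum \<epsilon> A Ab (k - 1) + of_real (\<epsilon> k) * A k"
      using partial_momentum_Suc[of "k - 1" \<epsilon> A Ab] k by auto
    moreover have "ext0 \<epsilon> \<epsilon>t (k - 1) \<noteq> 0" "ext0 \<epsilon> \<epsilon>t (k - 2) \<noteq> 0" using et k by auto
    ultimately show ?thesis by simp (simp add: algebra_simps)
  qed
  \<comment> \<open>\<open>ext0\<close> at 0 is \<open>\<epsilon> 1\<close>, which cancels from
    \<open>Ab 1 * (\<epsilon> 1 * Ab 1) / \<epsilon> 1\<close> and leaves the initial value of
    \<open>Dm\<close>.\<close>
  moreover have "\<epsilon> 1 \<noteq> 0" using et[of 0] by (simp add: ext0_def)
  moreover have "k - 1 - 1 = k - 2" for k :: nat by simp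
  ultimately show ?thesis
    unfolding D_eqs_def Let_def partial_momentum_1
    by (auto simp: ext0_def power2_eq_square)
qed

text \<open>Alternating induction: the value of \<open>Dm j\<close> determines that of
  \<open>Dp (Suc j)\<close> after cancelling \<open>Ab j\<close>, and the difference equation then
  returns the value of \<open>Dm (Suc j)\<close>.\<close>

lemma D_eqs_unique:
  assumes et: "\<And>k. k \<le> n - 3 \<Longrightarrow> ext0 \<epsilon> \<epsilon>t k \<noteq> 0"
    and D: "D_eqs n \<epsilon> \<epsilon>t A Ab Dp Dm" and Ab: "\<And>k. k \<in> {1..n-2} \<Longrightarrow> Ab k \<noteq> 0"
    and k: "k \<in> {2..n-2}"
  shows "of_real (ext0 \<epsilon> \<epsilon>t (k - 2)) * Dp k = Ab k * partial_momentum \<epsilon> A Ab (k - 1)"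
proof -
  have p: "Ab j * Dp (Suc j) = Ab (Suc j) * Dm j"
    and m: "of_real (ext0 \<epsilon> \<epsilon>t j) * Dm (Suc j)
      = of_real (ext0 \<epsilon> \<epsilon>t (j - 1)) * Dp (Suc j) + of_real (\<epsilon> (Suc j)) * A (Suc j) * Ab (Suc j)"
    if j: "1 \<le> j" "Suc j \<le> n - 2" for j
  proof -
    have "Suc j \<in> {2..n-2}" using j by auto
    then have "Ab (Suc j - 1) * Dp (Suc j) = Ab (Suc j) * Dm (Suc j - 1)"
      "of_real (ext0 \<epsilon> \<epsilon>t (Suc j - 1)) * Dm (Suc j) - of_real (ext0 \<epsilon> \<epsilon>t (Suc j - 2)) * Dp (Suc j)
        = of_real (\<epsilon> (Suc j)) * A (Suc j) * Ab (Suc j)"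
      using D unfolding D_eqs_def Let_def by blast+
    then show "Ab j * Dp (Suc j) = Ab (Suc j) * Dm j"
      "of_real (ext0 \<epsilon> \<epsilon>t j) * Dm (Suc j)
      = of_real (ext0 \<epsilon> \<epsilon>t (j - 1)) * Dp (Suc j) + of_real (\<epsilon> (Suc j)) * A (Suc j) * Ab (Suc j)"
      by (simp_all add: algebra_simps numeral_2_eq_2)
  qed
  have step: "of_real (ext0 \<epsilon> \<epsilon>t (j - 1)) * Dp (Suc j) = Ab (Suc j) * partial_momentum \<epsilon> A Ab j"
    if Dm: "of_real (ext0 \<epsilon> \<epsilon>t (j - 1)) * Dm j = Ab j * partial_momentum \<epsilon> A Ab j"
      and j: "1 \<le> j" "Suc j \<le> n - 2" for j
  proof -
    have "Ab j * (of_real (ext0 \<epsilon> \<epsilon>t (j - 1)) * Dp (Suc j))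
        = Ab (Suc j) * (of_real (ext0 \<epsilon> \<epsilon>t (j - 1)) * Dm j)"
      using p[OF j] by (simp add: algebra_simps)
    then have "Ab j * (of_real (ext0 \<epsilon> \<epsilon>t (j - 1)) * Dp (Suc j))
        = Ab j * (Ab (Suc j) * partial_momentum \<epsilon> A Ab j)"
      unfolding Dm by (simp add: algebra_simps)
    then show ?thesis using Ab[of j] j by simp
  qed
  have "of_real (ext0 \<epsilon> \<epsilon>t (j - 1)) * Dm j = Ab j * partial_momentum \<epsilon> A Ab j"
    if "1 \<le> j" "j \<le> n - 2" for j
    using that
  proof (induction j rule: nat_induct_at_least)
    case base
    then show ?case using D
      by (simp add: D_eqs_def Let_def ext0_def partial_momentum_1[unfolded One_nat_def] power2_eq_square)
  next
    case (Suc j)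
    then show ?case using step[of j] m[of j] by (simp add: partial_momentum_Suc algebra_simps)
  qed
  from step[OF this, of "k - 1"] k show ?thesis by (auto simp: numeral_2_eq_2)
qed

text \<open>The real-part condition after elimination of \<open>D\<close>, multiplied by its denominators.\<close>

definition reduced_eqs ::
    "nat \<Rightarrow> (nat \<Rightarrow> real) \<Rightarrow> (nat \<Rightarrow> real) \<Rightarrow> (nat \<Rightarrow> complex) \<Rightarrow> (nat \<Rightarrow> complex)
     \<Rightarrow> (nat \<Rightarrow> complex) \<Rightarrow> (nat \<Rightarrow> complex) \<Rightarrow> bool" where
  "reduced_eqs n \<epsilon> \<epsilon>t A Ab s st \<longleftrightarrow> vertex_eqs n \<epsilon> \<epsilon>t s st \<and>
     (\<forall>k\<in>{2..n-2}. of_real (\<epsilon> k) * (Ab k * partial_momentum \<epsilon> A Ab (k - 1)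
          + A k * partial_momentum \<epsilon> Ab A (k - 1))
        + 2 * (of_real (\<epsilon> k) * s k) * (of_real (ext0 \<epsilon> \<epsilon>t (k - 2)) * ext0 s st (k - 2))
        + of_real ((\<epsilon> k)\<^sup>2 + (ext0 \<epsilon> \<epsilon>t (k - 2))\<^sup>2 - (ext0 \<epsilon> \<epsilon>t (k - 1))\<^sup>2) = 0)"

text \<open>The second equation is the first multiplied by \<open>2 * e * t\<close>.\<close>

lemma real_part_eq_iff:
  fixes s sx P Q D D' :: complex and e t u :: real
  assumes "e \<noteq> 0" "t \<noteq> 0" "of_real t * D = P" "of_real t * D' = Q"
  shows "(D + D') / 2 = - (s * sx + of_real ((e\<^sup>2 + t\<^sup>2 - u\<^sup>2) / (2 * e * t))) \<longleftrightarrow>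
    of_real e * (P + Q) + 2 * (of_real e * s) * (of_real t * sx) + of_real (e\<^sup>2 + t\<^sup>2 - u\<^sup>2) = 0"
proof -
  have "of_real e * (P + Q) + 2 * (of_real e * s) * (of_real t * sx) + of_real (e\<^sup>2 + t\<^sup>2 - u\<^sup>2)
      = 2 * of_real e * of_real t *
        ((D + D') / 2 + (s * sx + of_real ((e\<^sup>2 + t\<^sup>2 - u\<^sup>2) / (2 * e * t))))"
    using assms(1,2) by (simp add: field_simps flip: assms(3,4))
  then show ?thesis using assms(1,2) by (simp only: eq_neg_iff_add_eq_0) simp
qed

text \<open>Only the values of \<open>Dp\<close> and \<open>Dp'\<close> enter, so the equivalence
  serves both the explicit solution and an arbitrary one whose values are known by
  uniqueness.\<close>

lemma reduced_eqs_iff: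
  assumes n: "n \<ge> 4" and \<epsilon>: "\<And>k. k \<in> {1..n-2} \<Longrightarrow> \<epsilon> k \<noteq> 0"
    and et: "\<And>k. k \<le> n - 3 \<Longrightarrow> ext0 \<epsilon> \<epsilon>t k \<noteq> 0"
    and Dp: "\<And>k. k \<in> {2..n-2} \<Longrightarrow>
      of_real (ext0 \<epsilon> \<epsilon>t (k - 2)) * Dp k = Ab k * partial_momentum \<epsilon> A Ab (k - 1)"
    and Dp': "\<And>k. k \<in> {2..n-2} \<Longrightarrow>
      of_real (ext0 \<epsilon> \<epsilon>t (k - 2)) * Dp' k = A k * partial_momentum \<epsilon> Ab A (k - 1)"
  shows "reduced_eqs n \<epsilon> \<epsilon>t A Ab s st \<longleftrightarrow> vertex_eqs n \<epsilon> \<epsilon>t s st \<and>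
    (\<forall>k\<in>{1..n-3}. (Dp (k + 1) + Dp' (k + 1)) / 2
         = - (s (k + 1) * ext0 s st (k - 1) + of_real (\<sigma> \<epsilon> \<epsilon>t (k + 1))))"
proof -
  have shift: "(\<forall>k\<in>{2..n-2}. Q k) \<longleftrightarrow> (\<forall>k\<in>{1..n-3}. Q (k + 1))" for Q
  proof -
    have *: "n - 2 = Suc (n - 3)" using n by arith
    have "{2..n-2} = Suc ` {1..n-3}"
      unfolding * image_Suc_atLeastAtMost by (simp add: numeral_2_eq_2)
    then show ?thesis by (auto simp del: image_Suc_atLeastAtMost)
  qed
  have *: "(of_real (\<epsilon> k) * (Ab k * partial_momentum \<epsilon> A Ab (k - 1)
          + A k * partial_momentum \<epsilon> Ab A (k - 1))
        + 2 * (of_real (\<epsilon> k) * s k) * (of_real (ext0 \<epsilon> \<epsilon>t (k - 2)) * ext0 s st (k - 2))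
        + of_real ((\<epsilon> k)\<^sup>2 + (ext0 \<epsilon> \<epsilon>t (k - 2))\<^sup>2 - (ext0 \<epsilon> \<epsilon>t (k - 1))\<^sup>2) = 0)
      \<longleftrightarrow> (Dp k + Dp' k) / 2 = - (s k * ext0 s st (k - 2) + of_real (\<sigma> \<epsilon> \<epsilon>t k))"
    if k: "k \<in> {2..n-2}" for k
    unfolding \<sigma>_def Let_def
    by (rule real_part_eq_iff[symmetric]) (use k \<epsilon> et Dp Dp' in auto)
  have "reduced_eqs n \<epsilon> \<epsilon>t A Ab s st \<longleftrightarrow> vertex_eqs n \<epsilon> \<epsilon>t s st \<and>
    (\<forall>k\<in>{2..n-2}. (Dp k + Dp' k) / 2 = - (s k * ext0 s st (k - 2) + of_real (\<sigma> \<epsilon> \<epsilon>t k)))"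
    unfolding reduced_eqs_def using * by blast
  then show ?thesis unfolding shift by (simp add: numeral_2_eq_2)
qed

section \<open>Passage between the algebraic momentum equations and their reduced form\<close>

lemma momentum_eqs_alg_if_reduced:
  assumes n: "n \<ge> 4" and \<epsilon>: "\<And>k. k \<in> {1..n-2} \<Longrightarrow> \<epsilon> k \<noteq> 0"
    and et: "\<And>k. k \<le> n - 3 \<Longrightarrow> ext0 \<epsilon> \<epsilon>t k \<noteq> 0"
    and red: "reduced_eqs n \<epsilon> \<epsilon>t (A_of \<alpha> w s) (Abar_of \<alpha> w s) s st"
  shows "\<exists>Dp Dm Dp' Dm'. momentum_eqs_alg n \<alpha> \<epsilon> \<epsilon>t w s st Dp Dm Dp' Dm'"
proof -
  let ?A = "A_of \<alpha> w s" and ?B = "Abar_of \<alpha> w s"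
  define Dp Dm where "Dp A B k = B k * partial_momentum \<epsilon> A B (k - 1) / of_real (ext0 \<epsilon> \<epsilon>t (k - 2))"
    and "Dm A B k = B k * partial_momentum \<epsilon> A B k / of_real (ext0 \<epsilon> \<epsilon>t (k - 1))" for A B k
  have sol: "D_eqs n \<epsilon> \<epsilon>t A B (Dp A B) (Dm A B)" for A B
    unfolding Dp_def Dm_def by (rule D_eqs_solution) (use et n in auto)
  have "of_real (ext0 \<epsilon> \<epsilon>t (k - 2)) * Dp A B k = B k * partial_momentum \<epsilon> A B (k - 1)"
    if "k \<in> {2..n-2}" for A B k
  proof -
    have "k - 2 \<le> n - 3" using that by auto
    then show ?thesis using et by (simp add: Dp_def)
  qed
  then have "vertex_eqs n \<epsilon> \<epsilon>t s st \<and>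
    (\<forall>k\<in>{1..n-3}. (Dp ?A ?B (k + 1) + Dp ?B ?A (k + 1)) / 2
         = - (s (k + 1) * ext0 s st (k - 1) + of_real (\<sigma> \<epsilon> \<epsilon>t (k + 1))))"
    using reduced_eqs_iff[of n \<epsilon> \<epsilon>t "Dp ?A ?B" ?B ?A "Dp ?B ?A" s st] n \<epsilon> et red by auto
  with sol[of ?A ?B] sol[of ?B ?A] show ?thesis unfolding momentum_eqs_alg_def Let_def by blast
qed

text \<open>\<open>D_eqs_unique\<close> is applied to the equations and to their formal conjugates,
  in which \<open>A\<close> and \<open>Abar\<close> change places; hence both have to be
  nonzero.\<close>

lemma reduced_if_momentum_eqs_alg:
  assumes n: "n \<ge> 4" and \<epsilon>: "\<And>k. k \<in> {1..n-2} \<Longrightarrow> \<epsilon> k \<noteq> 0"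
    and et: "\<And>k. k \<le> n - 3 \<Longrightarrow> ext0 \<epsilon> \<epsilon>t k \<noteq> 0"
    and A: "\<And>k. k \<in> {1..n-2} \<Longrightarrow> A_of \<alpha> w s k \<noteq> 0"
      "\<And>k. k \<in> {1..n-2} \<Longrightarrow> Abar_of \<alpha> w s k \<noteq> 0"
    and mom: "momentum_eqs_alg n \<alpha> \<epsilon> \<epsilon>t w s st Dp Dm Dp' Dm'"
  shows "reduced_eqs n \<epsilon> \<epsilon>t (A_of \<alpha> w s) (Abar_of \<alpha> w s) s st"
proof -
  let ?A = "A_of \<alpha> w s" and ?B = "Abar_of \<alpha> w s"
  have D: "D_eqs n \<epsilon> \<epsilon>t ?A ?B Dp Dm" "D_eqs n \<epsilon> \<epsilon>t ?B ?A Dp' Dm'"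
    using mom unfolding momentum_eqs_alg_def Let_def by blast+
  show ?thesis
    by (rule reduced_eqs_iff[THEN iffD2, OF n \<epsilon> et
          D_eqs_unique[OF et D(1) A(2)] D_eqs_unique[OF et D(2) A(1)]])
      (use mom in \<open>auto simp: momentum_eqs_alg_def Let_def\<close>)
qed

section \<open>Products of partial momenta with their formal conjugates\<close>

lemma A_mult_Abar: "A_of \<alpha> w s k * Abar_of \<alpha> w s k = 1 + (s k)\<^sup>2"
proof -
  have "a_of \<alpha> w k * inverse (a_of \<alpha> w k) = 1" by (simp add: a_of_def)
  moreover have "A_of \<alpha> w s k * Abar_of \<alpha> w s k
      = a_of \<alpha> w k * inverse (a_of \<alpha> w k) * ((1 + \<i> * s k) * (1 - \<i> * s k))"
    by (simp add: A_of_def Abar_of_def)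
  ultimately show ?thesis by (simp add: algebra_simps power2_eq_square)
qed

lemma vertex_eqs_step:
  assumes "vertex_eqs n \<epsilon> \<epsilon>t s st" "1 \<le> j" "Suc j \<le> n - 2"
  shows "of_real (ext0 \<epsilon> \<epsilon>t (j - 1)) * ext0 s st (j - 1)
    = of_real (\<epsilon> (Suc j)) * s (Suc j) + of_real (ext0 \<epsilon> \<epsilon>t j) * ext0 s st j"
proof -
  have "Suc j \<in> {2..n-2}" using assms by auto
  then have "of_real (\<epsilon> (Suc j)) * s (Suc j) + of_real (ext0 \<epsilon> \<epsilon>t (Suc j - 1)) * ext0 s st (Suc j - 1)
        - of_real (ext0 \<epsilon> \<epsilon>t (Suc j - 2)) * ext0 s st (Suc j - 2) = 0"
    using assms(1) unfolding vertex_eqs_def Let_def by blast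
  then show ?thesis by (simp add: algebra_simps numeral_2_eq_2)
qed

text \<open>Induction on \<open>k\<close>. On expanding \<open>(X + e * A) * (Y + e * B)\<close> the
  reduced equation supplies the cross terms and \<open>A_mult_Abar\<close> the last one. The result
  completes to the square of \<open>\<tau> - e * s (Suc k)\<close>, which the vertex equation
  identifies as the next exchanged momentum.\<close>

lemma partial_momentum_product:
  assumes red: "reduced_eqs n \<epsilon> \<epsilon>t (A_of \<alpha> w s) (Abar_of \<alpha> w s) s st" and k: "1 \<le> k" "k \<le> n - 2"
  shows "partial_momentum \<epsilon> (A_of \<alpha> w s) (Abar_of \<alpha> w s) k
      * partial_momentum \<epsilon> (Abar_of \<alpha> w s) (A_of \<alpha> w s) k
    = (of_real (ext0 \<epsilon> \<epsilon>t (k - 1)))\<^sup>2 + (of_real (ext0 \<epsilon> \<epsilon>t (k - 1)) * ext0 s st (k - 1))\<^sup>2"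
  using k
proof (induction k rule: nat_induct_at_least)
  case base
  have "of_real (\<epsilon> 1) * Abar_of \<alpha> w s 1 * (of_real (\<epsilon> 1) * A_of \<alpha> w s 1)
      = (of_real (\<epsilon> 1))\<^sup>2 * (A_of \<alpha> w s 1 * Abar_of \<alpha> w s 1)"
    by (simp add: power2_eq_square)
  then show ?case
    by (simp add: partial_momentum_1[unfolded One_nat_def] A_mult_Abar ext0_def algebra_simps power_mult_distrib)
next
  case (Suc k)
  define X where "X = partial_momentum \<epsilon> (A_of \<alpha> w s) (Abar_of \<alpha> w s) k"
  define Y where "Y = partial_momentum \<epsilon> (Abar_of \<alpha> w s) (A_of \<alpha> w s) k"
  define A B e where "A = A_of \<alpha> w s (Suc k)" and "B = Abar_of \<alpha> w s (Suc k)"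
    and "e = complex_of_real (\<epsilon> (Suc k))"
  define t u :: complex where "t = of_real (ext0 \<epsilon> \<epsilon>t (k - 1))" and "u = of_real (ext0 \<epsilon> \<epsilon>t k)"
  define \<tau> \<upsilon> where "\<tau> = t * ext0 s st (k - 1)" and "\<upsilon> = u * ext0 s st k"
  have "Suc k \<in> {2..n-2}" using Suc by auto
  then have R: "e * (B * X + A * Y) + 2 * (e * s (Suc k)) * \<tau> + (e\<^sup>2 + t\<^sup>2 - u\<^sup>2) = 0"
    using red unfolding reduced_eqs_def
    by (fastforce simp: X_def Y_def A_def B_def e_def t_def u_def \<tau>_def numeral_2_eq_2)
  have V: "\<tau> = e * s (Suc k) + \<upsilon>"
    using vertex_eqs_step[of n \<epsilon> \<epsilon>t s st k] red Suc
    by (simp add: reduced_eqs_def \<tau>_def \<upsilon>_def e_def t_def u_def)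
  have AB: "A * B = 1 + (s (Suc k))\<^sup>2" by (simp add: A_def B_def A_mult_Abar)
  have IH: "X * Y = t\<^sup>2 + \<tau>\<^sup>2" using Suc by (simp add: X_def Y_def t_def \<tau>_def)
  have "(X + e * A) * (Y + e * B) = X * Y + e * (B * X + A * Y) + e\<^sup>2 * (A * B)"
    by (simp add: algebra_simps power2_eq_square)
  also have "\<dots> = t\<^sup>2 + \<tau>\<^sup>2 - (2 * (e * s (Suc k)) * \<tau> + (e\<^sup>2 + t\<^sup>2 - u\<^sup>2)) + e\<^sup>2 * (1 + (s (Suc k))\<^sup>2)"
    using R unfolding IH AB by (simp add: algebra_simps eq_neg_iff_add_eq_0)
  also have "\<dots> = u\<^sup>2 + (\<tau> - e * s (Suc k))\<^sup>2"
    by (simp add: algebra_simps power2_eq_square)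
  also have "\<dots> = u\<^sup>2 + \<upsilon>\<^sup>2" by (simp add: V)
  finally show ?case
    using Suc.hyps by (simp add: partial_momentum_Suc X_def Y_def A_def B_def e_def u_def \<upsilon>_def)
qed

section \<open>The accessory equations\<close>

text \<open>Descending induction from the last vertex, where \<open>st (n - 3) = 0\<close>: an
  exchanged segment carries the sum of the external momenta beyond it. At \<open>k = 0\<close> the
  exchanged segment is the first line.\<close>

lemma tail_momentum:
  assumes V: "vertex_eqs n \<epsilon> \<epsilon>t s st" and n: "n \<ge> 4" and k: "k \<le> n - 3"
  shows "(\<Sum>i=k+2..n-2. of_real (\<epsilon> i) * s i) = of_real (ext0 \<epsilon> \<epsilon>t k) * ext0 s st k"
  using k
proof (induction k rule: inc_induct)
  case base
  then show ?case using V n by (simp add: vertex_eqs_def Let_def ext0_def)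
next
  case (step k)
  then have "k + 2 \<le> n - 2" by auto
  then have "(\<Sum>i=k+2..n-2. of_real (\<epsilon> i) * s i)
      = of_real (\<epsilon> (k + 2)) * s (k + 2) + (\<Sum>i=Suc k+2..n-2. of_real (\<epsilon> i) * s i)"
    by (simp add: sum.atLeast_Suc_atMost)
  also have "\<dots> = of_real (ext0 \<epsilon> \<epsilon>t k) * ext0 s st k"
    unfolding step.IH using vertex_eqs_step[OF V, of "Suc k"] \<open>k + 2 \<le> n - 2\<close> by simp
  finally show ?case .
qed

text \<open>The substitution turns \<open>c i * (1 - z i) - \<epsilon> i\<close> into
  \<open>- \<i> * \<alpha> * \<epsilon> i * s i\<close>. So \<open>I_pp\<close> is
  \<open>2 * pi\<close> times an exchanged momentum by \<open>tail_momentum\<close>, while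
  \<open>I_pm\<close> and \<open>I_mp\<close> are \<open>2 * pi * \<i>\<close> times the partial
  momentum and its formal conjugate; \<open>partial_momentum_product\<close> concludes.\<close>

lemma accessory_eqs_if_reduced:
  assumes n: "n \<ge> 4" and \<alpha>: "\<alpha> > 0" and z1: "z 1 = 0"
    and z: "\<And>k. k \<in> {1..n-2} \<Longrightarrow> z k \<noteq> 1"
    and red: "reduced_eqs n \<epsilon> \<epsilon>t (A_of \<alpha> (w_of z) s) (Abar_of \<alpha> (w_of z) s) s st"
    and c1: "c 1 = of_real (\<epsilon> 1) * (1 + \<i> * of_real \<alpha> * s 1)"
    and c: "\<And>k. k \<in> {2..n-2} \<Longrightarrow> c k * (1 - z k) = of_real (\<epsilon> k) * (1 - \<i> * of_real \<alpha> * s k)"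
  shows "accessory_eqs n \<alpha> \<epsilon> \<epsilon>t z c"
proof -
  let ?A = "A_of \<alpha> (w_of z) s" and ?B = "Abar_of \<alpha> (w_of z) s"
  have V: "vertex_eqs n \<epsilon> \<epsilon>t s st" using red by (simp add: reduced_eqs_def)
  have b: "c i * (1 - z i) - of_real (\<epsilon> i) = - \<i> * of_real \<alpha> * (of_real (\<epsilon> i) * s i)"
    if "i \<in> {2..n-2}" for i
    using c[OF that] by (simp add: algebra_simps)
  have tail: "(\<Sum>i=k+2..n-2. c i * (1 - z i) - of_real (\<epsilon> i))
      = - \<i> * of_real \<alpha> * (of_real (ext0 \<epsilon> \<epsilon>t k) * ext0 s st k)" if "k \<le> n - 3" for k
  proof -
    have "(\<Sum>i=k+2..n-2. c i * (1 - z i) - of_real (\<epsilon> i))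
      = (\<Sum>i=k+2..n-2. - \<i> * of_real \<alpha> * (of_real (\<epsilon> i) * s i))"
      by (intro sum.cong refl b) auto
    also have "\<dots> = - \<i> * of_real \<alpha> * (\<Sum>i=k+2..n-2. of_real (\<epsilon> i) * s i)"
      by (simp only: sum_distrib_left)
    finally show ?thesis unfolding tail_momentum[OF V n that] .
  qed
  have tot: "(\<Sum>i=2..n-2. c i * (1 - z i) - of_real (\<epsilon> i)) = - \<i> * of_real \<alpha> * (of_real (\<epsilon> 1) * s 1)"
    using tail[of 0] unfolding add_0 by (simp add: ext0_def)
  \<comment> \<open>With \<open>a_of\<close> equal to 1 at the first point, the constant part of
    \<open>I_pm\<close> becomes the first summand \<open>\<epsilon> 1 * Abar 1\<close> of the
    partial momentum, up to the factor \<open>\<alpha>\<close>.\<close>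
  have a1: "a_of \<alpha> (w_of z) 1 = 1" using z1 by (simp add: a_of_def w_of_def)
  have a: "a_of \<alpha> (w_of z) i = (1 - z i) powr of_real \<alpha>"
    "inverse (a_of \<alpha> (w_of z) i) = (1 - z i) powr - of_real \<alpha>" if "i \<in> {2..n-2}" for i
    using a_of_w_of[of z i \<alpha>] z[of i] that by (auto simp: powr_minus)
  have pp: "I_pp \<alpha> \<epsilon> n z c k = 2 * of_real pi * (of_real (ext0 \<epsilon> \<epsilon>t k) * ext0 s st k)"
    if "k \<le> n - 3" for k
    unfolding I_pp_def tail[OF that] using \<alpha> by (simp add: field_simps)
  have pm: "I_pm \<alpha> \<epsilon> n z c k = 2 * of_real pi * \<i> * partial_momentum \<epsilon> ?A ?B (k + 1)"
    if k: "k \<in> {1..n-3}" for k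
  proof -
    have "(\<Sum>i=2..k+1. (1 - z i) powr of_real \<alpha> * (c i * (1 - z i) - of_real (\<epsilon> i * (1 + \<alpha>))))
        = (\<Sum>i=2..k+1. - of_real \<alpha> * (of_real (\<epsilon> i) * ?A i))"
    proof (rule sum.cong)
      fix i assume "i \<in> {2..k+1}"
      then have i: "i \<in> {2..n-2}" using k n by auto
      show "(1 - z i) powr of_real \<alpha> * (c i * (1 - z i) - of_real (\<epsilon> i * (1 + \<alpha>)))
          = - of_real \<alpha> * (of_real (\<epsilon> i) * ?A i)"
        unfolding A_of_def a(1)[OF i] c[OF i] by (simp add: algebra_simps)
    qed simp
    also have "\<dots> = - of_real \<alpha> * (\<Sum>i=2..k+1. of_real (\<epsilon> i) * ?A i)"
      by (simp only: sum_distrib_left)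
    finally have "I_pm \<alpha> \<epsilon> n z c k = 2 * of_real pi * \<i> / of_real \<alpha> *
        (of_real \<alpha> * (of_real (\<epsilon> 1) * ?B 1 + (\<Sum>i=2..k+1. of_real (\<epsilon> i) * ?A i)))"
      unfolding I_pm_def tot Abar_of_def[of _ _ _ 1] a1 by (simp add: algebra_simps)
    then show ?thesis using \<alpha> by (simp add: partial_momentum_split)
  qed
  \<comment> \<open>The sign of \<open>\<alpha>\<close> changes in \<open>I_pm\<close> but not
    inside \<open>c\<close>, so \<open>1 + \<i> * s i\<close> becomes \<open>1 - \<i> * s i\<close>:
    the roles of \<open>A\<close> and \<open>Abar\<close> are exchanged.\<close>
  have mp: "I_mp \<alpha> \<epsilon> n z c k = 2 * of_real pi * \<i> * partial_momentum \<epsilon> ?B ?A (k + 1)"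
    if k: "k \<in> {1..n-3}" for k
  proof -
    have "(\<Sum>i=2..k+1. (1 - z i) powr of_real (- \<alpha>) * (c i * (1 - z i) - of_real (\<epsilon> i * (1 + - \<alpha>))))
        = (\<Sum>i=2..k+1. of_real \<alpha> * (of_real (\<epsilon> i) * ?B i))"
    proof (rule sum.cong)
      fix i assume "i \<in> {2..k+1}"
      then have i: "i \<in> {2..n-2}" using k n by auto
      show "(1 - z i) powr of_real (- \<alpha>) * (c i * (1 - z i) - of_real (\<epsilon> i * (1 + - \<alpha>)))
          = of_real \<alpha> * (of_real (\<epsilon> i) * ?B i)"
        unfolding Abar_of_def a(2)[OF i] c[OF i] by (simp add: algebra_simps)
    qed simp
    also have "\<dots> = of_real \<alpha> * (\<Sum>i=2..k+1. of_real (\<epsilon> i) * ?B i)"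
      by (simp only: sum_distrib_left)
    finally have "I_mp \<alpha> \<epsilon> n z c k = 2 * of_real pi * \<i> / of_real (- \<alpha>) *
        (- of_real \<alpha> * (of_real (\<epsilon> 1) * ?A 1 + (\<Sum>i=2..k+1. of_real (\<epsilon> i) * ?B i)))"
      unfolding I_mp_def I_pm_def tot A_of_def[of _ _ _ 1] a1 by (simp add: algebra_simps)
    then show ?thesis using \<alpha> by (simp add: partial_momentum_split)
  qed
  have "(I_pp \<alpha> \<epsilon> n z c k)\<^sup>2 + I_mp \<alpha> \<epsilon> n z c k * I_pm \<alpha> \<epsilon> n z c k = of_real (- 4 * pi\<^sup>2 * (\<epsilon>t k)\<^sup>2)"
    if k: "k \<in> {1..n-3}" for k
  proof -
    let ?X = "partial_momentum \<epsilon> ?A ?B (k + 1)" and ?Y = "partial_momentum \<epsilon> ?B ?A (k + 1)"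
    define u where "u = complex_of_real (ext0 \<epsilon> \<epsilon>t k) * ext0 s st k"
    have XY: "?X * ?Y = (of_real (\<epsilon>t k))\<^sup>2 + u\<^sup>2"
      using partial_momentum_product[OF red, of "k + 1"] k n by (auto simp: u_def ext0_def)
    have "(2 * of_real pi * u)\<^sup>2 + 2 * of_real pi * \<i> * ?Y * (2 * of_real pi * \<i> * ?X)
        = 4 * (of_real pi)\<^sup>2 * (u\<^sup>2 - ?X * ?Y)"
      by (simp add: algebra_simps power2_eq_square)
    then show ?thesis using pp[of k] pm[OF k] mp[OF k] k unfolding XY by (simp add: u_def)
  qed
  moreover have "c 1 = - (\<Sum>i=2..n-2. c i * (1 - z i) - of_real (\<epsilon> i)) + of_real (\<epsilon> 1)"
    unfolding tot c1 by (simp add: algebra_simps)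
  ultimately show ?thesis unfolding accessory_eqs_def by blast
qed

section \<open>Existence of a common root\<close>

text \<open>The angular parameters of a potential are known only at the indices
  \<open>1, ..., n - 2\<close>; other values must not matter.\<close>

lemma reduced_eqs_cong:
  assumes red: "reduced_eqs n \<epsilon> \<epsilon>t (A_of \<alpha> w s) (Abar_of \<alpha> w s) s st"
    and n: "n \<ge> 4" and eq: "\<And>k. k \<in> {1..n-2} \<Longrightarrow> s k = s' k"
  shows "reduced_eqs n \<epsilon> \<epsilon>t (A_of \<alpha> w s') (Abar_of \<alpha> w s') s' st"
proof -
  have x: "ext0 s' st = ext0 s st" using eq[of 1] n by (simp add: ext0_def)
  have A: "A_of \<alpha> w s' k = A_of \<alpha> w s k" "Abar_of \<alpha> w s' k = Abar_of \<alpha> w s k"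
    if "k \<in> {1..n-2}" for k using eq[OF that] by (simp_all add: A_of_def Abar_of_def)
  have pm: "partial_momentum \<epsilon> (A_of \<alpha> w s') (Abar_of \<alpha> w s') (k - 1)
      = partial_momentum \<epsilon> (A_of \<alpha> w s) (Abar_of \<alpha> w s) (k - 1)"
    "partial_momentum \<epsilon> (Abar_of \<alpha> w s') (A_of \<alpha> w s') (k - 1)
      = partial_momentum \<epsilon> (Abar_of \<alpha> w s) (A_of \<alpha> w s) (k - 1)"
    if "k \<in> {2..n-2}" for k
    unfolding partial_momentum_def by (rule sum.cong; use A that in auto)+
  have "vertex_eqs n \<epsilon> \<epsilon>t s' st"
    using red eq unfolding reduced_eqs_def vertex_eqs_def Let_def x by simp
  moreover have "of_real (\<epsilon> k) * (Abar_of \<alpha> w s' k * partial_momentum \<epsilon> (A_of \<alpha> w s') (Abar_of \<alpha> w s') (k - 1)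
          + A_of \<alpha> w s' k * partial_momentum \<epsilon> (Abar_of \<alpha> w s') (A_of \<alpha> w s') (k - 1))
        + 2 * (of_real (\<epsilon> k) * s' k) * (of_real (ext0 \<epsilon> \<epsilon>t (k - 2)) * ext0 s' st (k - 2))
        + of_real ((\<epsilon> k)\<^sup>2 + (ext0 \<epsilon> \<epsilon>t (k - 2))\<^sup>2 - (ext0 \<epsilon> \<epsilon>t (k - 1))\<^sup>2) = 0"
    if k: "k \<in> {2..n-2}" for k
  proof -
    have k1: "k \<in> {1..n-2}" using k by auto
    show ?thesis unfolding x pm[OF k] A[OF k1] eq[OF k1, symmetric]
      using red k unfolding reduced_eqs_def by blast
  qed
  ultimately show ?thesis unfolding reduced_eqs_def by blast
qed

text \<open>With \<open>t\<^sub>1 = - s\<^sub>1\<close> the first segment looks like the others,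
  since \<open>a_of\<close> is 1 there. The vertex equations determine \<open>st\<close>, and
  \<open>st (n - 3) = 0\<close> becomes the linear form of \<open>chain_root_exists\<close>.
  Injectivity of \<open>a_of\<close> makes the coefficients \<open>c j k\<close> nonzero.\<close>

lemma reduced_root_exists:
  assumes n: "n \<ge> 4" and \<epsilon>: "\<And>k. k \<in> {1..n-2} \<Longrightarrow> \<epsilon> k \<noteq> 0"
    and \<epsilon>t: "\<And>k. k \<in> {1..n-3} \<Longrightarrow> \<epsilon>t k \<noteq> 0"
    and a1: "a_of \<alpha> w 1 = 1" and inj: "inj_on (a_of \<alpha> w) {1..n-2}"
  shows "\<exists>s st. reduced_eqs n \<epsilon> \<epsilon>t (A_of \<alpha> w s) (Abar_of \<alpha> w s) s st"
proof -
  define a where "a = a_of \<alpha> w"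
  define e where "e k = complex_of_real (\<epsilon> k)" for k
  define \<kappa> where "\<kappa> k = complex_of_real ((\<epsilon> k)\<^sup>2 + (ext0 \<epsilon> \<epsilon>t (k - 2))\<^sup>2 - (ext0 \<epsilon> \<epsilon>t (k - 1))\<^sup>2)" for k
  have a0: "a k \<noteq> 0" for k by (simp add: a_def a_of_def)
  \<comment> \<open>These are the coefficients of \<open>t j * t k\<close>, of \<open>t k\<close>
    (negated: of \<open>t j\<close>) and of 1 in the contribution of the pair \<open>j < k\<close>
    to the reduced equation, where the \<open>- 2\<close> comes from the exchanged momentum.\<close>
  define c where "c j k = e k * e j * (a j / a k + a k / a j - 2)" for j k
  define P where "P j k = e k * e j * \<i> * (a k / a j - a j / a k)" for j k
  define R where "R j k = e k * e j * (a j / a k + a k / a j)" for j k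
  have c0: "c j k \<noteq> 0" if "1 \<le> j" "j < k" "k \<le> n - 2" for j k
  proof -
    have "j \<in> {1..n-2}" "k \<in> {1..n-2}" using that by auto
    then have "a j \<noteq> a k" using inj_onD[OF inj, of j k] that by (auto simp: a_def)
    moreover have "a j / a k + a k / a j - 2 = (a j - a k)\<^sup>2 / (a j * a k)"
      using a0 by (simp add: field_simps power2_eq_square)
    ultimately show ?thesis using a0 \<epsilon> that by (simp add: c_def e_def)
  qed
  have e0: "e j \<noteq> 0" if "j \<in> {1..n-2}" for j using \<epsilon>[OF that] by (simp add: e_def)
  have "n - 2 \<ge> 1" using n by simp
  from chain_root_exists[where m = "n - 2" and c = c and e = e and p = "\<lambda>k. \<Sum>j=1..<k. P j k"
      and q = "\<lambda>j k. - P j k" and r = "\<lambda>k. (\<Sum>j=1..<k. R j k) + \<kappa> k", OF c0 e0 this]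
  obtain t where lin: "(\<Sum>j=1..n-2. e j * t j) = 0"
    and eq: "\<And>k. k \<in> {2..n-2} \<Longrightarrow> t k * ((\<Sum>j=1..<k. c j k * t j) + (\<Sum>j=1..<k. P j k))
      + ((\<Sum>j=1..<k. - P j k * t j) + ((\<Sum>j=1..<k. R j k) + \<kappa> k)) = 0"
    by blast
  \<comment> \<open>The sign of \<open>t 1\<close> is undone here. Solving the vertex equations
    successively gives \<open>- W (k + 1)\<close> as momentum of exchanged segment \<open>k\<close>;
    the value \<open>st 0\<close> is arbitrary, as \<open>ext0\<close> replaces it by
    \<open>s 1\<close>.\<close>
  define s where "s k = (if k = 1 then - t 1 else t k)" for k
  define W where "W k = (\<Sum>j=1..k. e j * t j)" for k
  define st where "st k = - W (k + 1) / of_real (\<epsilon>t k)" for k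
  have x: "of_real (ext0 \<epsilon> \<epsilon>t k) * ext0 s st k = - W (k + 1)" if "k \<le> n - 3" for k
    using \<epsilon>t[of k] that by (cases "k = 0") (simp_all add: ext0_def s_def st_def e_def W_def)
  have ind: "i - 2 + 1 = i - 1" "i - 1 + 1 = i" if "i \<in> {2..n-2}" for i using that by auto
  have V: "vertex_eqs n \<epsilon> \<epsilon>t s st"
  proof -
    have "of_real (\<epsilon> i) * s i + of_real (ext0 \<epsilon> \<epsilon>t (i - 1)) * ext0 s st (i - 1)
        - of_real (ext0 \<epsilon> \<epsilon>t (i - 2)) * ext0 s st (i - 2) = 0" if i: "i \<in> {2..n-2}" for i
    proof -
      have "i - 1 \<le> n - 3" "i - 2 \<le> n - 3" using i by auto
      from this[THEN x] have "of_real (ext0 \<epsilon> \<epsilon>t (i - 1)) * ext0 s st (i - 1) = - W i"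
        "of_real (ext0 \<epsilon> \<epsilon>t (i - 2)) * ext0 s st (i - 2) = - W (i - 1)"
        by (simp_all only: ind[OF i])
      moreover have "W i = W (i - 1) + e i * t i" using i by (cases i) (auto simp: W_def)
      ultimately show ?thesis using i by (simp add: s_def e_def)
    qed
    moreover have "n - 3 + 1 = n - 2" using n by simp
    then have "st (n - 3) = 0" using lin by (simp only: st_def W_def) simp
    ultimately show ?thesis unfolding vertex_eqs_def Let_def by blast
  qed
  \<comment> \<open>The exceptional first summand becomes regular:
    \<open>Abar 1 = 1 - \<i> * s 1 = 1 + \<i> * t 1\<close>, as \<open>a 1 = 1\<close>.\<close>
  have X: "partial_momentum \<epsilon> (A_of \<alpha> w s) (Abar_of \<alpha> w s) k = (\<Sum>j=1..k. e j * (a j * (1 + \<i> * t j)))"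
    "partial_momentum \<epsilon> (Abar_of \<alpha> w s) (A_of \<alpha> w s) k = (\<Sum>j=1..k. e j * (inverse (a j) * (1 - \<i> * t j)))"
    for k
    unfolding partial_momentum_def
    by (rule sum.cong; use a1 in \<open>auto simp: A_of_def Abar_of_def a_def e_def s_def\<close>)+
  have "of_real (\<epsilon> k) * (Abar_of \<alpha> w s k * partial_momentum \<epsilon> (A_of \<alpha> w s) (Abar_of \<alpha> w s) (k - 1)
          + A_of \<alpha> w s k * partial_momentum \<epsilon> (Abar_of \<alpha> w s) (A_of \<alpha> w s) (k - 1))
        + 2 * (of_real (\<epsilon> k) * s k) * (of_real (ext0 \<epsilon> \<epsilon>t (k - 2)) * ext0 s st (k - 2))
        + of_real ((\<epsilon> k)\<^sup>2 + (ext0 \<epsilon> \<epsilon>t (k - 2))\<^sup>2 - (ext0 \<epsilon> \<epsilon>t (k - 1))\<^sup>2) = 0"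
    if k: "k \<in> {2..n-2}" for k
  proof -
    have AB: "A_of \<alpha> w s k = a k * (1 + \<i> * t k)" "Abar_of \<alpha> w s k = inverse (a k) * (1 - \<i> * t k)"
      and sk: "s k = t k"
      using k by (auto simp: A_of_def Abar_of_def a_def s_def)
    have xk: "of_real (ext0 \<epsilon> \<epsilon>t (k - 2)) * ext0 s st (k - 2) = - (\<Sum>j=1..k-1. e j * t j)"
      using x[of "k - 2"] k unfolding ind[OF k] W_def by auto
    have "{1..k-1} = {1..<k}" using k by auto
    note [simp] = this[unfolded One_nat_def]
    have step: "e k * (inverse (a k) * (1 - \<i> * t k) * (e j * (a j * (1 + \<i> * t j)))
          + a k * (1 + \<i> * t k) * (e j * (inverse (a j) * (1 - \<i> * t j)))) - 2 * (e k * t k) * (e j * t j)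
        = t k * (c j k * t j + P j k) + (- P j k * t j + R j k)" for j
    proof -
      have "y * (1 - \<i> * u) * (x' * (1 + \<i> * v)) + y' * (1 + \<i> * u) * (x * (1 - \<i> * v)) - 2 * u * v
          = u * ((x' * y + y' * x - 2) * v + \<i> * (y' * x - x' * y))
            + (- (\<i> * (y' * x - x' * y)) * v + (x' * y + y' * x))" for x x' y y' u v
        by (simp add: algebra_simps)
      from arg_cong[OF this[of "inverse (a k)" "t k" "a j" "t j" "a k" "inverse (a j)"], of "\<lambda>x. e k * e j * x"]
      show ?thesis by (simp add: c_def P_def R_def divide_inverse algebra_simps)
    qed
    have "e k * (inverse (a k) * (1 - \<i> * t k) * (\<Sum>j=1..<k. e j * (a j * (1 + \<i> * t j)))
          + a k * (1 + \<i> * t k) * (\<Sum>j=1..<k. e j * (inverse (a j) * (1 - \<i> * t j))))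
        + 2 * (e k * t k) * - (\<Sum>j=1..<k. e j * t j)
      = (\<Sum>j=1..<k. e k * (inverse (a k) * (1 - \<i> * t k) * (e j * (a j * (1 + \<i> * t j)))
          + a k * (1 + \<i> * t k) * (e j * (inverse (a j) * (1 - \<i> * t j)))) - 2 * (e k * t k) * (e j * t j))"
      by (simp only: sum_subtractf sum.distrib sum_distrib_left[symmetric]) simp
    also have "\<dots> = t k * ((\<Sum>j=1..<k. c j k * t j) + (\<Sum>j=1..<k. P j k))
      + ((\<Sum>j=1..<k. - P j k * t j) + (\<Sum>j=1..<k. R j k))"
      unfolding step by (simp only: sum.distrib sum_distrib_left[symmetric])
    also have "\<dots> = - \<kappa> k" using eq[OF k] by (simp add: algebra_simps eq_neg_iff_add_eq_0)
    finally show ?thesis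
      unfolding X AB sk xk \<kappa>_def[symmetric] e_def[symmetric] by simp
  qed
  with V show ?thesis unfolding reduced_eqs_def by blast
qed

text \<open>The stated relation of the unknowns defines \<open>c\<close> from \<open>s\<close>, and
  potentials with these gradients exist. The sign in \<open>angular\<close> for \<open>k = 1\<close>
  matches the sign in \<open>c 1\<close>, so \<open>s\<close> is recovered exactly; this serves
  complex and real roots alike.\<close>

lemma common_root_exists:
  assumes n: "n \<ge> 4" and \<alpha>: "\<alpha> > 0" and \<epsilon>: "\<And>k. k \<in> {1..n-2} \<Longrightarrow> \<epsilon> k \<noteq> 0" and z1: "z 1 = 0"
    and circle: "\<And>k. k \<in> {1..n-2} \<Longrightarrow> dist (z k) 1 = 1"
    and red: "reduced_eqs n \<epsilon> \<epsilon>t (A_of \<alpha> (w_of z) s) (Abar_of \<alpha> (w_of z) s) s st"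
  obtains f S where
    "holomorphic_potential_at (n - 2) f z" "holomorphic_potential_at (n - 2) S (w_of z)"
    "potentials_related n \<epsilon> z f S" "accessory_eqs n \<alpha> \<epsilon> \<epsilon>t z (partial_deriv f z)"
    "\<And>k. k \<in> {1..n-2} \<Longrightarrow> angular \<alpha> \<epsilon> (partial_deriv S (w_of z)) k = s k"
proof -
  have zn: "z k \<noteq> 1" if "k \<in> {1..n-2}" for k using circle[OF that] by auto
  define c where "c k = of_real (\<epsilon> k) * (1 + (if k = 1 then 1 else - 1) * \<i> * of_real \<alpha> * s k) / (1 - z k)" for k
  obtain f S where fS: "holomorphic_potential_at (n - 2) f z" "holomorphic_potential_at (n - 2) S (w_of z)"
    "potentials_related n \<epsilon> z f S"
    and f: "\<And>k. k \<in> {1..n-2} \<Longrightarrow> partial_deriv f z k = c k"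
    and S: "\<And>k. k \<in> {1..n-2} \<Longrightarrow>
       partial_deriv S (w_of z) k = \<i> * (c k * (1 - z k) - of_real (\<epsilon> k))"
    using potentials_exist[where z = z and n = n, OF circle] by metis
  have "accessory_eqs n \<alpha> \<epsilon> \<epsilon>t z (partial_deriv f z)"
    by (rule accessory_eqs_if_reduced[OF n \<alpha> z1 zn red]) (use f n zn z1 in \<open>auto simp: c_def\<close>)
  moreover have "angular \<alpha> \<epsilon> (partial_deriv S (w_of z)) k = s k" if k: "k \<in> {1..n-2}" for k
    unfolding angular_def S[OF k] c_def using \<epsilon>[OF k] zn[OF k] \<alpha> by (auto simp: field_simps)
  ultimately show ?thesis using that fS by blast
qed

section \<open>Complex and real common roots, and the relation forced on the unknowns\<close>

theorem proposition5p7: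
  fixes n :: nat and \<alpha> :: real and \<epsilon> \<epsilon>t :: "nat \<Rightarrow> real" and z :: "nat \<Rightarrow> complex"
  assumes n: "n \<ge> 4"
    and \<alpha>: "0 < \<alpha>" "\<alpha> \<le> 1"
    and \<epsilon>: "\<And>k. k \<in> {1..n-2} \<Longrightarrow> \<epsilon> k > 0"
    and \<epsilon>t: "\<And>k. k \<in> {1..n-3} \<Longrightarrow> \<epsilon>t k > 0"
    and z1: "z 1 = 0"
    and circle: "\<And>p. p \<in> {1..n-2} \<Longrightarrow> dist (z p) 1 = 1"
    and distinct: "inj_on z {1..n-2}"
  shows "weakly_equivalent_at (n - 2) z (w_of z) (potentials_related n \<epsilon> z)
           (accessory_system n \<alpha> \<epsilon> \<epsilon>t) (momentum_system_alg n \<alpha> \<epsilon> \<epsilon>t) \<and>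
         ((\<exists>s st Dp Dm. momentum_eqs n \<alpha> \<epsilon> \<epsilon>t (w_of z) s st Dp Dm) \<longrightarrow>
         weakly_equivalent_at (n - 2) z (w_of z) (potentials_related n \<epsilon> z)
           (accessory_system n \<alpha> \<epsilon> \<epsilon>t) (momentum_system n \<alpha> \<epsilon> \<epsilon>t)) \<and>
         (\<forall>f S. holomorphic_potential_at (n - 2) f z \<longrightarrow>
           holomorphic_potential_at (n - 2) S (w_of z) \<longrightarrow>
           potentials_related n \<epsilon> z f S \<longrightarrow>
           (let c = partial_deriv f z; s = angular \<alpha> \<epsilon> (partial_deriv S (w_of z)) in
            c 1 = of_real (\<epsilon> 1) * ((1 + \<i> * of_real \<alpha> * s 1) / (1 - z 1)) \<and>
            (\<forall>k\<in>{2..n-2}. c k = of_real (\<epsilon> k) * ((1 - \<i> * of_real \<alpha> * s k) / (1 - z k)))))"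
proof (intro conjI impI allI)
  have \<epsilon>0: "\<epsilon> k \<noteq> 0" if "k \<in> {1..n-2}" for k using \<epsilon>[OF that] by simp
  have \<epsilon>t0: "\<epsilon>t k \<noteq> 0" if "k \<in> {1..n-3}" for k using \<epsilon>t[OF that] by simp
  have et: "ext0 \<epsilon> \<epsilon>t k \<noteq> 0" if "k \<le> n - 3" for k using ext0_nonzero[OF n \<epsilon> \<epsilon>t that] .
  have zn: "z k \<noteq> 1" if "k \<in> {1..n-2}" for k using circle[OF that] by auto
  have a1: "a_of \<alpha> (w_of z) 1 = 1" using z1 by (simp add: a_of_def w_of_def)
  \<comment> \<open>For \<open>0 < \<alpha> \<le> 1\<close> the number
    \<open>\<alpha> * Ln (1 - z r)\<close> stays in the principal strip, so \<open>Ln\<close>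
    recovers it from the power. Distinct points therefore have distinct powers.\<close>
  have inj: "inj_on (a_of \<alpha> (w_of z)) {1..n-2}"
  proof (rule inj_onI)
    fix p q assume p: "p \<in> {1..n-2}" and q: "q \<in> {1..n-2}"
      and eq: "a_of \<alpha> (w_of z) p = a_of \<alpha> (w_of z) q"
    have Ln_a: "Ln (a_of \<alpha> (w_of z) r) = of_real \<alpha> * Ln (1 - z r)" if r: "r \<in> {1..n-2}" for r
    proof -
      have "- pi < Im (Ln (1 - z r))" "Im (Ln (1 - z r)) \<le> pi"
        using mpi_less_Im_Ln Im_Ln_le_pi zn[OF r] by auto
      then have "\<alpha> * - pi < \<alpha> * Im (Ln (1 - z r))" "\<alpha> * Im (Ln (1 - z r)) \<le> \<alpha> * pi"
        using \<alpha>(1) by (simp_all only: mult_strict_left_mono mult_left_mono less_imp_le)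
      moreover have "\<alpha> * pi \<le> pi" using \<alpha>(2) by (simp add: mult_left_le_one_le \<alpha>(1) less_imp_le)
      ultimately have "- pi < \<alpha> * Im (Ln (1 - z r))" "\<alpha> * Im (Ln (1 - z r)) \<le> pi" by linarith+
      then have "Ln (exp (of_real \<alpha> * Ln (1 - z r))) = of_real \<alpha> * Ln (1 - z r)"
        by (intro Ln_exp) simp_all
      then show ?thesis using a_of_w_of[of z r \<alpha>] zn[OF r] by (simp add: powr_def)
    qed
    have "Ln (1 - z p) = Ln (1 - z q)" using Ln_a[OF p] Ln_a[OF q] eq \<alpha>(1) by simp
    then have "1 - z p = 1 - z q" using zn[OF p] zn[OF q] by (metis exp_Ln right_minus_eq)
    then show "p = q" using distinct p q by (simp add: inj_on_def)
  qed
  show "weakly_equivalent_at (n - 2) z (w_of z) (potentials_related n \<epsilon> z)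
           (accessory_system n \<alpha> \<epsilon> \<epsilon>t) (momentum_system_alg n \<alpha> \<epsilon> \<epsilon>t)"
  proof -
    obtain s st where red: "reduced_eqs n \<epsilon> \<epsilon>t (A_of \<alpha> (w_of z) s) (Abar_of \<alpha> (w_of z) s) s st"
      using reduced_root_exists[where \<epsilon> = \<epsilon> and \<epsilon>t = \<epsilon>t, OF n \<epsilon>0 \<epsilon>t0 a1 inj] by blast
    obtain f S where fS: "holomorphic_potential_at (n - 2) f z" "holomorphic_potential_at (n - 2) S (w_of z)"
      "potentials_related n \<epsilon> z f S" "accessory_eqs n \<alpha> \<epsilon> \<epsilon>t z (partial_deriv f z)"
      and ang: "\<And>k. k \<in> {1..n-2} \<Longrightarrow> angular \<alpha> \<epsilon> (partial_deriv S (w_of z)) k = s k"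
      using common_root_exists[where \<epsilon> = \<epsilon> and \<epsilon>t = \<epsilon>t and z = z, OF n \<alpha>(1) \<epsilon>0 z1 circle red] by blast
    have "reduced_eqs n \<epsilon> \<epsilon>t (A_of \<alpha> (w_of z) (angular \<alpha> \<epsilon> (partial_deriv S (w_of z))))
        (Abar_of \<alpha> (w_of z) (angular \<alpha> \<epsilon> (partial_deriv S (w_of z))))
        (angular \<alpha> \<epsilon> (partial_deriv S (w_of z))) st"
      by (rule reduced_eqs_cong[OF red n]) (simp add: ang)
    from momentum_eqs_alg_if_reduced[where \<epsilon> = \<epsilon> and \<epsilon>t = \<epsilon>t, OF n \<epsilon>0 et this]
    obtain Dp Dm Dp' Dm' where
      "momentum_eqs_alg n \<alpha> \<epsilon> \<epsilon>t (w_of z) (angular \<alpha> \<epsilon> (partial_deriv S (w_of z))) st Dp Dm Dp' Dm'"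
      by blast
    then have "momentum_system_alg n \<alpha> \<epsilon> \<epsilon>t (w_of z) (partial_deriv S (w_of z)) (st, Dp, Dm, Dp', Dm')"
      by (simp add: momentum_system_alg_def)
    with fS show ?thesis unfolding weakly_equivalent_at_def accessory_system_def by blast
  qed
  show "weakly_equivalent_at (n - 2) z (w_of z) (potentials_related n \<epsilon> z)
           (accessory_system n \<alpha> \<epsilon> \<epsilon>t) (momentum_system n \<alpha> \<epsilon> \<epsilon>t)"
    if root: "\<exists>s st Dp Dm. momentum_eqs n \<alpha> \<epsilon> \<epsilon>t (w_of z) s st Dp Dm"
  proof -
    obtain s st Dp Dm where mom: "momentum_eqs n \<alpha> \<epsilon> \<epsilon>t (w_of z) s st Dp Dm" using root by blast
    have w: "w_of z k \<in> \<real>" if "k \<in> {1..n-2}" for k using w_of_real circle[OF that] by blast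
    obtain Dp' Dm' where alg: "momentum_eqs_alg n \<alpha> \<epsilon> \<epsilon>t (w_of z) (of_real \<circ> s) (of_real \<circ> st) Dp Dm Dp' Dm'"
      using mom momentum_eqs_iff_alg[where w = "w_of z" and \<epsilon>t = \<epsilon>t, OF n w \<epsilon>t] by blast
    \<comment> \<open>Real angular parameters at real \<open>w\<close> make \<open>A\<close> and
      \<open>Abar\<close> complex conjugate and nonzero, so the \<open>D\<close> of the given root
      can be eliminated.\<close>
    have B: "Abar_of \<alpha> (w_of z) (of_real \<circ> s) k \<noteq> 0" if "k \<in> {1..n-2}" for k
      using cnj_A_of(3)[of "w_of z" k "of_real \<circ> s"] w[OF that] by simp
    have A: "A_of \<alpha> (w_of z) (of_real \<circ> s) k \<noteq> 0" if "k \<in> {1..n-2}" for k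
      using cnj_A_of(1)[of "w_of z" k "of_real \<circ> s" \<alpha>] w[OF that] B[OF that] by auto
    have red: "reduced_eqs n \<epsilon> \<epsilon>t (A_of \<alpha> (w_of z) (of_real \<circ> s)) (Abar_of \<alpha> (w_of z) (of_real \<circ> s))
        (of_real \<circ> s) (of_real \<circ> st)"
      by (rule reduced_if_momentum_eqs_alg[OF n \<epsilon>0 et A B alg])
    obtain f S where fS: "holomorphic_potential_at (n - 2) f z" "holomorphic_potential_at (n - 2) S (w_of z)"
      "potentials_related n \<epsilon> z f S" "accessory_eqs n \<alpha> \<epsilon> \<epsilon>t z (partial_deriv f z)"
      and ang: "\<And>k. k \<in> {1..n-2} \<Longrightarrow> angular \<alpha> \<epsilon> (partial_deriv S (w_of z)) k = (of_real \<circ> s) k"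
      using common_root_exists[where \<epsilon> = \<epsilon> and \<epsilon>t = \<epsilon>t and z = z, OF n \<alpha>(1) \<epsilon>0 z1 circle red] by blast
    have "momentum_system n \<alpha> \<epsilon> \<epsilon>t (w_of z) (partial_deriv S (w_of z)) (st, Dp, Dm)"
      unfolding momentum_system_def using mom ang by auto
    with fS show ?thesis unfolding weakly_equivalent_at_def accessory_system_def by blast
  qed
  fix f S
  assume fS: "holomorphic_potential_at (n - 2) f z" "holomorphic_potential_at (n - 2) S (w_of z)"
    "potentials_related n \<epsilon> z f S"
  define G where "G = partial_deriv S (w_of z)"
  \<comment> \<open>This holds for every pair of related potentials, not only for those constructed
    as common roots.\<close>
  have rel: "partial_deriv f z k * (1 - z k) = of_real (\<epsilon> k) - \<i> * G k" if "k \<in> {1..n-2}" for k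
    unfolding G_def using gradient_relation[OF fS that zn[OF that]] .
  have "partial_deriv f z k = of_real (\<epsilon> k)
      * ((1 + (if k = 1 then 1 else - 1) * \<i> * of_real \<alpha> * angular \<alpha> \<epsilon> G k) / (1 - z k))"
    if k: "k \<in> {1..n-2}" for k
  proof -
    have "of_real (\<epsilon> k) * (1 + (if k = 1 then 1 else - 1) * \<i> * of_real \<alpha> * angular \<alpha> \<epsilon> G k)
        = partial_deriv f z k * (1 - z k)"
      unfolding rel[OF k] using \<alpha>(1) \<epsilon>0[OF k] by (simp add: angular_def field_simps)
    then show ?thesis using zn[OF k] by (simp add: eq_divide_eq)
  qed
  from this[of 1] this[of "_ :: nat"] n
  show "let c = partial_deriv f z; s = angular \<alpha> \<epsilon> (partial_deriv S (w_of z)) in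
            c 1 = of_real (\<epsilon> 1) * ((1 + \<i> * of_real \<alpha> * s 1) / (1 - z 1)) \<and>
            (\<forall>k\<in>{2..n-2}. c k = of_real (\<epsilon> k) * ((1 - \<i> * of_real \<alpha> * s k) / (1 - z k)))"
    unfolding Let_def G_def by auto
qed

end
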